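(* Let $n\ge 1$. The map $\mathrm{orientedruffle}:\mathrm{Ruffle}_n\to \bar S_n$ does the right thing with respect to $\mathrm{hand}$ on $\mathrm{Ruffle}_n$ and the oriented rising number on $\bar S_n$. Consequently the oriented rising number is a lumping of $\bar S_n$: the sums $\sum_{w} w$ over all $w\in\bar S_n$ with a given oriented rising number form a basis of a subalgebra of the group algebra $\mathbf{Q}[\bar S_n]$ (the oriented rising algebra), and this subalgebra is commutative.
   Context: Permutations are composed left to right: $(\sigma\tau)(i)=\tau(\sigma(i))$. $S_n$ is the symmetric group on $\{1,\dots,n\}$; $\sigma(i)$ is the position to which the card originally in position $i$ is moved. $\bar S_n$ is the group of oriented (signed) permutations: bijections $w$ of $\{\pm1,\dots,\pm n\}$ with $w(-i)=-w(i)$, also composed left to right; the card in position $i$ is moved to position $|w(i)|$ and is turned over iff $w(i)<0$. The ruffle monoid $\mathrm{Ruffle}_n$ has as elements the pairs $(a,x)$, with $a\ge1$ an integer and $x=(x_1,\dots,x_n)$ integers, $0\le x_i<a$. Each $(a,x)$ describes an $a$-handed ruffle: let $c_j=\#\{i:x_i=j\}$; hand $j$ ($0\le j<a$) receives the cards $c_0+\dots+c_{j-1}+1,\dots,c_0+\dots+c_j$; the odd-numbered hands are turned over as a bunch (order reversed, each card's orientation flipped); then the hands are interleaved so that the card in final position $i$ comes from hand $x_i$. Thus, in the positions $i$ with $x_i=j$, read in increasing order, the cards of hand $j$ appear in increasing order and unflipped if $j$ is even, and in decreasing order and flipped if $j$ is odd. The resulting oriented permutation is $\mathrm{orientedruffle}(a,x)\in\bar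 S_n$, and $\mathrm{ruffle}(a,x)\in S_n$ is the permutation obtained by ignoring orientations. $S_n$ acts on lists by $(x^\sigma)_{\sigma(i)}=x_i$. The product in $\mathrm{Ruffle}_n$ is $(a,x)*(b,y)=(ab,z)$, where, with $x'=x^{\mathrm{ruffle}(b,y)}$, $z_i=bx'_i+y_i$ if $x'_i$ is even and $z_i=bx'_i+b-1-y_i$ if $x'_i$ is odd. The function $\mathrm{hand}$ on $\mathrm{Ruffle}_n$ is $\mathrm{hand}(a,x)=a$. The oriented rising number of $w\in\bar S_n$ is the minimum $a$ such that $w=\mathrm{orientedruffle}(a,x)$ for some $x$. A function $\mu$ on a monoid $M$ is a lumping if its equivalence classes (level sets) are finite and the class sums form a basis of a subalgebra of $\mathbf{Q}[M]$ (a linear subspace closed under multiplication). Given a lumping $\mu$ of $M$ and a function $\nu$ with finite level sets on a monoid $N$, a monoid homomorphism $f:M\to N$ does the right thing with respect to $\mu$ and $\nu$ if the elements $\sum_{x\in C}f(x)$, $C$ ranging over the $\mu$-classes, belong to and span the subspace of $\mathbf{Q}[N]$ spanned by the class sums of $\nu$. The function $\mathrm{hand}$ is a lumping of $\mathrm{Ruffle}_n$. *)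

theory Defs
  imports Complex_Main "HOL-Algebra.Group" "HOL-Library.Poly_Mapping" "HOL-Combinatorics.Permutations"
begin

section \<open>Monoid algebras over the rationals\<close>

text \<open>
  An element of \<open>\<rat>[M]\<close> is a finitely supported function \<open>p :: 'a \<Rightarrow>\<^sub>0 rat\<close> whose support lies in
  \<open>carrier M\<close>; the monoid element \<open>x\<close> itself is \<open>Poly_Mapping.single x 1\<close>.
  The multiplication that Poly_Mapping provides is tied to an additive type class, so the
  product is defined here relative to the monoid structure \<open>M\<close>.
\<close>

definition malg_carrier :: "('a, 'm) monoid_scheme \<Rightarrow> ('a \<Rightarrow>\<^sub>0 rat) set" where
  "malg_carrier M = {p. Poly_Mapping.keys p \<subseteq> carrier M}"

definition malg_scale :: "rat \<Rightarrow> ('a \<Rightarrow>\<^sub>0 rat) \<Rightarrow> ('a \<Rightarrow>\<^sub>0 rat)" where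
  "malg_scale c p = Poly_Mapping.map ((*) c) p"

definition malg_mult ::
  "('a, 'm) monoid_scheme \<Rightarrow> ('a \<Rightarrow>\<^sub>0 rat) \<Rightarrow> ('a \<Rightarrow>\<^sub>0 rat) \<Rightarrow> ('a \<Rightarrow>\<^sub>0 rat)" where
  "malg_mult M p q = (\<Sum>x\<in>Poly_Mapping.keys p. \<Sum>y\<in>Poly_Mapping.keys q.
     Poly_Mapping.single (x \<otimes>\<^bsub>M\<^esub> y) (Poly_Mapping.lookup p x * Poly_Mapping.lookup q y))"

lemma lookup_malg_scale [simp]:
  "Poly_Mapping.lookup (malg_scale c p) x = c * Poly_Mapping.lookup p x"
  by (simp add: malg_scale_def Poly_Mapping.map.rep_eq when_def)

global_interpretation malg: vector_space malg_scale
  by unfold_locales (auto intro!: poly_mapping_eqI simp: lookup_add algebra_simps)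

definition malg_subalgebra :: "('a, 'm) monoid_scheme \<Rightarrow> ('a \<Rightarrow>\<^sub>0 rat) set \<Rightarrow> bool" where
  "malg_subalgebra M A \<longleftrightarrow> A \<subseteq> malg_carrier M \<and> malg.subspace A \<and>
     (\<forall>p\<in>A. \<forall>q\<in>A. malg_mult M p q \<in> A)"

definition malg_basis_of :: "('a \<Rightarrow>\<^sub>0 rat) set \<Rightarrow> ('a \<Rightarrow>\<^sub>0 rat) set \<Rightarrow> bool" where
  "malg_basis_of B A \<longleftrightarrow> malg.independent B \<and> malg.span B = A"


section \<open>Lumpings and doing the right thing\<close>

definition level_sets :: "('a, 'm) monoid_scheme \<Rightarrow> ('a \<Rightarrow> 'c) \<Rightarrow> 'a set set" where
  "level_sets M \<mu> = (\<lambda>x. {y \<in> carrier M. \<mu> y = \<mu> x}) ` carrier M"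

definition finite_level_sets :: "('a, 'm) monoid_scheme \<Rightarrow> ('a \<Rightarrow> 'c) \<Rightarrow> bool" where
  "finite_level_sets M \<mu> \<longleftrightarrow> (\<forall>C \<in> level_sets M \<mu>. finite C)"

definition class_sums :: "('a, 'm) monoid_scheme \<Rightarrow> ('a \<Rightarrow> 'c) \<Rightarrow> ('a \<Rightarrow>\<^sub>0 rat) set" where
  "class_sums M \<mu> = (\<lambda>C. \<Sum>x\<in>C. Poly_Mapping.single x 1) ` level_sets M \<mu>"

definition lumping :: "('a, 'm) monoid_scheme \<Rightarrow> ('a \<Rightarrow> 'c) \<Rightarrow> bool" where
  "lumping M \<mu> \<longleftrightarrow> monoid M \<and> finite_level_sets M \<mu> \<and>
     (\<exists>A. malg_subalgebra M A \<and> malg_basis_of (class_sums M \<mu>) A)"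

definition monoid_hom :: "('a, 'm) monoid_scheme \<Rightarrow> ('b, 'k) monoid_scheme \<Rightarrow> ('a \<Rightarrow> 'b) set" where
  "monoid_hom M N = {f \<in> hom M N. f \<one>\<^bsub>M\<^esub> = \<one>\<^bsub>N\<^esub>}"

definition image_class_sums ::
  "('a, 'm) monoid_scheme \<Rightarrow> ('a \<Rightarrow> 'c) \<Rightarrow> ('a \<Rightarrow> 'b) \<Rightarrow> ('b \<Rightarrow>\<^sub>0 rat) set" where
  "image_class_sums M \<mu> f = (\<lambda>C. \<Sum>x\<in>C. Poly_Mapping.single (f x) 1) ` level_sets M \<mu>"

text \<open>
  The standing requirements (\<open>\<mu>\<close> is a lumping of \<open>M\<close>, the level sets of \<open>\<nu>\<close> on the monoid \<open>N\<close> are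
  finite, \<open>f\<close> is a monoid homomorphism) are part of the definition, so they are asserted whenever
  a map is said to do the right thing.
\<close>

definition does_the_right_thing ::
  "('a, 'm) monoid_scheme \<Rightarrow> ('b, 'k) monoid_scheme \<Rightarrow> ('a \<Rightarrow> 'c) \<Rightarrow> ('b \<Rightarrow> 'd) \<Rightarrow> ('a \<Rightarrow> 'b) \<Rightarrow> bool"
  where
  "does_the_right_thing M N \<mu> \<nu> f \<longleftrightarrow>
     lumping M \<mu> \<and> monoid N \<and> finite_level_sets N \<nu> \<and> f \<in> monoid_hom M N \<and>
     image_class_sums M \<mu> f \<subseteq> malg.span (class_sums N \<nu>) \<and>
     malg.span (image_class_sums M \<mu> f) = malg.span (class_sums N \<nu>)"


section \<open>Oriented permutations\<close>

text \<open>
  Oriented permutations are functions on all integers that are the identity outside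
  \<open>{\<plusminus>1, \<dots>, \<plusminus>n}\<close>. Composition is from left to right: \<open>(v w)(i) = w (v i)\<close>.
\<close>

definition oriented_perm_group :: "nat \<Rightarrow> (int \<Rightarrow> int) monoid" where
  "oriented_perm_group n =
     \<lparr>carrier = {w. w permutes ({- int n..int n} - {0}) \<and>
                    (\<forall>i \<in> {- int n..int n} - {0}. w (- i) = - w i)},
      monoid.mult = (\<lambda>v w. w \<circ> v),
      one = id\<rparr>"


section \<open>Ruffles\<close>

text \<open>
  An element of the ruffle monoid is a pair \<open>(a, x)\<close>, where the list \<open>x\<close> is represented by a function
  on \<open>{1..n}\<close> (extensional, that is \<open>undefined\<close> elsewhere).
\<close>

definition ruffles :: "nat \<Rightarrow> (nat \<times> (nat \<Rightarrow> nat)) set" where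
  "ruffles n = {(a, x). 1 \<le> a \<and> x \<in> {1..n} \<rightarrow>\<^sub>E {0..<a}}"

definition hand_size :: "nat \<Rightarrow> (nat \<Rightarrow> nat) \<Rightarrow> nat \<Rightarrow> nat" where
  "hand_size n x j = card {i \<in> {1..n}. x i = j}"

text \<open>
  Hand \<open>j\<close> consists of the cards in positions \<open>hand_start n x j + 1, \<dots>, hand_start n x j + hand_size n x j\<close>.
\<close>

definition hand_start :: "nat \<Rightarrow> (nat \<Rightarrow> nat) \<Rightarrow> nat \<Rightarrow> nat" where
  "hand_start n x j = (\<Sum>k<j. hand_size n x k)"

text \<open>
  The original position of the card that ends in position \<open>i\<close>. If \<open>i\<close> is the \<open>r\<close>-th of the
  positions with entry \<open>j = x i\<close>, this card is the \<open>r\<close>-th card of hand \<open>j\<close> for even \<open>j\<close>, and the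
  \<open>r\<close>-th card counted from the end of hand \<open>j\<close> for odd \<open>j\<close>.
\<close>

definition origin :: "nat \<Rightarrow> (nat \<Rightarrow> nat) \<Rightarrow> nat \<Rightarrow> nat" where
  "origin n x i =
     (let j = x i; r = card {k \<in> {1..i}. x k = j} in
      if even j then hand_start n x j + r
      else hand_start n x j + hand_size n x j + 1 - r)"

definition orientedruffle :: "nat \<Rightarrow> nat \<times> (nat \<Rightarrow> nat) \<Rightarrow> (int \<Rightarrow> int)" where
  "orientedruffle n = (\<lambda>(a, x).
     THE w. w \<in> carrier (oriented_perm_group n) \<and>
       (\<forall>i\<in>{1..n}. w (int (origin n x i)) = (if even (x i) then int i else - int i)))"

definition ruffle :: "nat \<Rightarrow> nat \<times> (nat \<Rightarrow> nat) \<Rightarrow> (nat \<Rightarrow> nat)" where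
  "ruffle n r = (\<lambda>i. nat \<bar>orientedruffle n r (int i)\<bar>)"

definition list_act :: "nat \<Rightarrow> (nat \<Rightarrow> nat) \<Rightarrow> (nat \<Rightarrow> nat) \<Rightarrow> (nat \<Rightarrow> nat)" where
  "list_act n \<sigma> x = (\<lambda>i\<in>{1..n}. x (inv_into {1..n} \<sigma> i))"

text \<open>The natural number subtraction below does not truncate, since \<open>y i < b\<close>.\<close>

definition ruffle_mult ::
  "nat \<Rightarrow> nat \<times> (nat \<Rightarrow> nat) \<Rightarrow> nat \<times> (nat \<Rightarrow> nat) \<Rightarrow> nat \<times> (nat \<Rightarrow> nat)" where
  "ruffle_mult n = (\<lambda>(a, x) (b, y).
     let x' = list_act n (ruffle n (b, y)) x in
     (a * b, \<lambda>i\<in>{1..n}. if even (x' i) then b * x' i + y i else b * x' i + (b - 1 - y i)))"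

definition ruffle_monoid :: "nat \<Rightarrow> (nat \<times> (nat \<Rightarrow> nat)) monoid" where
  "ruffle_monoid n =
     \<lparr>carrier = ruffles n, monoid.mult = ruffle_mult n, one = (1, \<lambda>i\<in>{1..n}. 0)\<rparr>"

definition hand :: "nat \<times> (nat \<Rightarrow> nat) \<Rightarrow> nat" where
  "hand = fst"

definition oriented_rising :: "nat \<Rightarrow> (int \<Rightarrow> int) \<Rightarrow> nat" where
  "oriented_rising n w = (LEAST a. \<exists>x. (a, x) \<in> ruffles n \<and> w = orientedruffle n (a, x))"

definition oriented_rising_algebra :: "nat \<Rightarrow> ((int \<Rightarrow> int) \<Rightarrow>\<^sub>0 rat) set" where
  "oriented_rising_algebra n =
     malg.span (class_sums (oriented_perm_group n) (oriented_rising n))"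

end

(* A list x yields the oriented permutation w iff, reading the cards k = 1, ..., n in their original
   order, the pairs (x at |w k|, w k) increase lexicographically, and the hand x at |w k| is even iff
   w k > 0. This criterion shows that orientedruffle is a homomorphism. For fixed w it says that the
   hands are m k + 2 e k, where m is the least admissible sequence of hands and e is any weakly
   increasing sequence, so the number of a-handed ruffles yielding w depends only on a and on the
   oriented rising number m n + 1. That number is 0 below and 1 at the oriented rising number, so the
   images of the hand sums and the rising class sums are related by a unitriangular matrix. Finally,
   the sum of all a-handed ruffles times the sum of all b-handed ones is the sum of all ab-handed
   ones, which gives both closure and commutativity. *)

theory Submission
  imports Defs
begin

section \<open>Monoid algebras\<close>

lemma malg_scale_single: "malg_scale c (Poly_Mapping.single x v) = Poly_Mapping.single x (c * v)"
  by (rule poly_mapping_eqI) (simp add: lookup_single when_def)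

text \<open>Indices outside the supports contribute \<open>single _ 0 = 0\<close>. Enlarging the
  ranges lets the products of two elements and of their sum be compared over a common index set,
  although the supports differ.\<close>

lemma malg_mult_superset:
  assumes "finite X" "finite Y" "Poly_Mapping.keys p \<subseteq> X" "Poly_Mapping.keys q \<subseteq> Y"
  shows "malg_mult M p q = (\<Sum>x\<in>X. \<Sum>y\<in>Y.
    Poly_Mapping.single (x \<otimes>\<^bsub>M\<^esub> y) (Poly_Mapping.lookup p x * Poly_Mapping.lookup q y))"
proof -
  have inner: "(\<Sum>y\<in>Poly_Mapping.keys q.
      Poly_Mapping.single (x \<otimes>\<^bsub>M\<^esub> y) (Poly_Mapping.lookup p x * Poly_Mapping.lookup q y))
    = (\<Sum>y\<in>Y. Poly_Mapping.single (x \<otimes>\<^bsub>M\<^esub> y) (Poly_Mapping.lookup p x * Poly_Mapping.lookup q y))"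
    for x
    by (rule sum.mono_neutral_left) (use assms in \<open>auto simp: in_keys_iff\<close>)
  show ?thesis
    unfolding malg_mult_def inner
    by (rule sum.mono_neutral_left) (use assms in \<open>auto simp: in_keys_iff\<close>)
qed

lemma linear_malg_mult_right: "Vector_Spaces.linear malg_scale malg_scale (malg_mult M p)"
proof (unfold_locales, goal_cases)
  case (1 q q')
  let ?Y = "Poly_Mapping.keys q \<union> Poly_Mapping.keys q'"
  note expand = malg_mult_superset[of "Poly_Mapping.keys p" ?Y p]
  have "malg_mult M p (q + q') = (\<Sum>x\<in>Poly_Mapping.keys p. \<Sum>y\<in>?Y.
    Poly_Mapping.single (x \<otimes>\<^bsub>M\<^esub> y) (Poly_Mapping.lookup p x * Poly_Mapping.lookup (q + q') y))"
    by (rule expand) (use Poly_Mapping.keys_add[of q q'] in auto)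
  also have "\<dots> = malg_mult M p q + malg_mult M p q'"
    by (simp add: expand lookup_add distrib_left single_add sum.distrib)
  finally show ?case .
next
  case (2 c q)
  have "malg_mult M p (malg_scale c q) = (\<Sum>x\<in>Poly_Mapping.keys p. \<Sum>y\<in>Poly_Mapping.keys q.
    Poly_Mapping.single (x \<otimes>\<^bsub>M\<^esub> y) (Poly_Mapping.lookup p x * Poly_Mapping.lookup (malg_scale c q) y))"
    by (rule malg_mult_superset) (auto simp: in_keys_iff)
  also have "\<dots> = malg_scale c (malg_mult M p q)"
    by (simp add: malg_mult_def malg.scale_sum_right malg_scale_single algebra_simps)
  finally show ?case .
qed

lemma linear_malg_mult_left: "Vector_Spaces.linear malg_scale malg_scale (\<lambda>p. malg_mult M p q)"
proof (unfold_locales, goal_cases)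
  case (1 p p')
  let ?X = "Poly_Mapping.keys p \<union> Poly_Mapping.keys p'"
  note expand = malg_mult_superset[of ?X "Poly_Mapping.keys q" _ q]
  have "malg_mult M (p + p') q = (\<Sum>x\<in>?X. \<Sum>y\<in>Poly_Mapping.keys q.
    Poly_Mapping.single (x \<otimes>\<^bsub>M\<^esub> y) (Poly_Mapping.lookup (p + p') x * Poly_Mapping.lookup q y))"
    by (rule expand) (use Poly_Mapping.keys_add[of p p'] in auto)
  also have "\<dots> = malg_mult M p q + malg_mult M p' q"
    by (simp add: expand lookup_add distrib_right single_add sum.distrib)
  finally show ?case .
next
  case (2 c p)
  have "malg_mult M (malg_scale c p) q = (\<Sum>x\<in>Poly_Mapping.keys p. \<Sum>y\<in>Poly_Mapping.keys q.
    Poly_Mapping.single (x \<otimes>\<^bsub>M\<^esub> y) (Poly_Mapping.lookup (malg_scale c p) x * Poly_Mapping.lookup q y))"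
    by (rule malg_mult_superset) (auto simp: in_keys_iff)
  also have "\<dots> = malg_scale c (malg_mult M p q)"
    by (simp add: malg_mult_def malg.scale_sum_right malg_scale_single algebra_simps)
  finally show ?case .
qed

interpretation malg_right: Vector_Spaces.linear malg_scale malg_scale "malg_mult M p" for M p
  by (rule linear_malg_mult_right)

interpretation malg_left: Vector_Spaces.linear malg_scale malg_scale "\<lambda>p. malg_mult M p q" for M q
  by (rule linear_malg_mult_left)

lemma malg_mult_single:
  "malg_mult M (Poly_Mapping.single x a) (Poly_Mapping.single y b) =
     Poly_Mapping.single (x \<otimes>\<^bsub>M\<^esub> y) (a * b)"
  by (subst malg_mult_superset[of "{x}" "{y}"]) auto

lemma malg_mult_sum_single:
  "malg_mult M (\<Sum>i\<in>A. Poly_Mapping.single (f i) 1) (\<Sum>j\<in>B. Poly_Mapping.single (g j) 1) =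
     (\<Sum>i\<in>A. \<Sum>j\<in>B. Poly_Mapping.single (f i \<otimes>\<^bsub>M\<^esub> g j) 1)"
  proof -
  have "malg_mult M (\<Sum>i\<in>A. Poly_Mapping.single (f i) 1) (\<Sum>j\<in>B. Poly_Mapping.single (g j) 1) =
     (\<Sum>j\<in>B. \<Sum>i\<in>A. Poly_Mapping.single (f i \<otimes>\<^bsub>M\<^esub> g j) 1)"
    by (simp add: malg_left.sum malg_right.sum malg_mult_single)
  also have "\<dots> = (\<Sum>i\<in>A. \<Sum>j\<in>B. Poly_Mapping.single (f i \<otimes>\<^bsub>M\<^esub> g j) 1)"
    by (rule sum.swap)
  finally show ?thesis .
qed

lemma malg_mult_in_span:
  assumes closed: "\<And>p q. p \<in> B \<Longrightarrow> q \<in> B \<Longrightarrow> malg_mult M p q \<in> malg.span B"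
    and p: "p \<in> malg.span B" and q: "q \<in> malg.span B"
  shows "malg_mult M p q \<in> malg.span B"
proof -
  \<comment> \<open>Linearity in the right factor handles \<open>q\<close> against a fixed generator
    \<open>p'\<close>; linearity in the left factor then handles \<open>p\<close>.\<close>
  have base: "malg_mult M p' q \<in> malg.span B" if "p' \<in> B" for p'
    using q
    by (induction q rule: malg.span_induct_alt)
      (auto simp: malg_right.add malg_right.scale malg_right.zero
        intro: malg.span_add malg.span_scale malg.span_zero closed[OF that])
  show ?thesis
    using p
    by (induction p rule: malg.span_induct_alt)
      (auto simp: malg_left.add malg_left.scale malg_left.zero
        intro: malg.span_add malg.span_scale malg.span_zero base)
qed

lemma malg_mult_commute_on_span:
  assumes comm: "\<And>p q. p \<in> B \<Longrightarrow> q \<in> B \<Longrightarrow> malg_mult M p q = malg_mult M q p"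
    and p: "p \<in> malg.span B" and q: "q \<in> malg.span B"
  shows "malg_mult M p q = malg_mult M q p"
proof -
  have base: "malg_mult M p' q = malg_mult M q p'" if "p' \<in> B" for p'
    using q
    by (induction q rule: malg.span_induct_alt)
      (auto simp: malg_right.add malg_right.scale malg_right.zero
        malg_left.add malg_left.scale malg_left.zero that comm)
  show ?thesis
    using p
    by (induction p rule: malg.span_induct_alt)
      (auto simp: malg_right.add malg_right.scale malg_right.zero
        malg_left.add malg_left.scale malg_left.zero base)
qed

lemma lookup_sum_single:
  "finite C \<Longrightarrow> Poly_Mapping.lookup (\<Sum>x\<in>C. Poly_Mapping.single x (1::rat)) y = (if y \<in> C then 1 else 0)"
  by (simp add: lookup_sum lookup_single when_def)

text \<open>Class sums have disjoint nonempty supports, so evaluating a vanishing combination at a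
  point \<open>x\<close> of one class isolates the coefficient of that class.\<close>

lemma class_sums_independent:
  assumes fin: "finite_level_sets M \<mu>"
  shows "malg.independent (class_sums M \<mu>)"
  unfolding malg.dependent_explicit
proof (rule notI, elim exE conjE bexE)
  fix T u v
  assume T: "finite T" "T \<subseteq> class_sums M \<mu>" and zero: "(\<Sum>v\<in>T. malg_scale (u v) v) = 0"
    and v: "v \<in> T" "u v \<noteq> 0"
  obtain x where x: "x \<in> carrier M"
    and v_eq: "v = (\<Sum>y\<in>{y \<in> carrier M. \<mu> y = \<mu> x}. Poly_Mapping.single y 1)"
    using T v by (auto simp: class_sums_def level_sets_def)
  have lookup_T: "Poly_Mapping.lookup t x = (if t = v then 1 else 0)" if t_in: "t \<in> T" for t
  proof -
    obtain z where z: "z \<in> carrier M"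
      and t_eq: "t = (\<Sum>y\<in>{y \<in> carrier M. \<mu> y = \<mu> z}. Poly_Mapping.single y 1)"
      using subsetD[OF T(2) t_in] by (auto simp: class_sums_def level_sets_def)
    have "finite {y \<in> carrier M. \<mu> y = \<mu> z}" "finite {y \<in> carrier M. \<mu> y = \<mu> x}"
      using fin z x by (auto simp: finite_level_sets_def level_sets_def)
    then have t: "Poly_Mapping.lookup t x = (if \<mu> x = \<mu> z then 1 else 0)"
      and v: "Poly_Mapping.lookup v x = 1"
      using x by (auto simp: t_eq v_eq lookup_sum_single)
    show ?thesis
    proof (cases "t = v")
      case True then show ?thesis using v by simp
    next
      case False
      then have "\<mu> x \<noteq> \<mu> z" by (auto simp: t_eq v_eq)
      then show ?thesis using t False by simp
    qed
  qed
  have "0 = Poly_Mapping.lookup (\<Sum>t\<in>T. malg_scale (u t) t) x"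
    by (simp add: zero)
  also have "\<dots> = (\<Sum>t\<in>T. if t = v then u t else 0)"
    unfolding lookup_sum by (rule sum.cong) (auto simp: lookup_T)
  also have "\<dots> = u v"
    using T v by simp
  finally show False using v by simp
qed

lemma span_class_sums_subset_carrier:
  assumes "finite_level_sets M \<mu>"
  shows "malg.span (class_sums M \<mu>) \<subseteq> malg_carrier M"
proof (rule malg.span_minimal)
  show "class_sums M \<mu> \<subseteq> malg_carrier M"
  proof
    fix p assume "p \<in> class_sums M \<mu>"
    then obtain C where C: "C \<in> level_sets M \<mu>" and p: "p = (\<Sum>x\<in>C. Poly_Mapping.single x 1)"
      by (auto simp: class_sums_def)
    have "finite C" "C \<subseteq> carrier M"
      using assms C by (auto simp: finite_level_sets_def level_sets_def)
    then show "p \<in> malg_carrier M"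
      by (auto simp: malg_carrier_def p in_keys_iff lookup_sum_single split: if_splits)
  qed
  show "malg.subspace (malg_carrier M)"
  proof (rule malg.subspaceI)
    show "x + y \<in> malg_carrier M" if "x \<in> malg_carrier M" "y \<in> malg_carrier M" for x y :: "'a \<Rightarrow>\<^sub>0 rat"
      using that Poly_Mapping.keys_add[of x y] by (auto simp: malg_carrier_def)
  qed (auto simp: malg_carrier_def in_keys_iff)
qed

text \<open>Independence is automatic and a subalgebra with the class sums as basis can only be
  their span, so closure of that span under products is all that must be supplied.\<close>

lemma lumpingI:
  assumes "monoid M" "finite_level_sets M \<mu>"
    and "\<And>p q. p \<in> malg.span (class_sums M \<mu>) \<Longrightarrow> q \<in> malg.span (class_sums M \<mu>) \<Longrightarrow>
      malg_mult M p q \<in> malg.span (class_sums M \<mu>)"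
  shows "malg_subalgebra M (malg.span (class_sums M \<mu>))"
    and "malg_basis_of (class_sums M \<mu>) (malg.span (class_sums M \<mu>))"
    and "lumping M \<mu>"
proof -
  show *: "malg_subalgebra M (malg.span (class_sums M \<mu>))"
    using assms span_class_sums_subset_carrier[OF assms(2)]
    by (simp add: malg_subalgebra_def)
  show **: "malg_basis_of (class_sums M \<mu>) (malg.span (class_sums M \<mu>))"
    using class_sums_independent[OF assms(2)] by (simp add: malg_basis_of_def)
  show "lumping M \<mu>"
    unfolding lumping_def using assms(1,2) * ** by blast
qed

section \<open>Oriented permutations\<close>

abbreviation oriented_perms :: "nat \<Rightarrow> (int \<Rightarrow> int) set" where
  "oriented_perms n \<equiv> carrier (oriented_perm_group n)"

text \<open>The image of \<open>w\<close> under the projection to unsigned permutations, as a map on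
  card numbers.\<close>

definition card_pos :: "(int \<Rightarrow> int) \<Rightarrow> nat \<Rightarrow> nat" where
  "card_pos w k = nat \<bar>w (int k)\<bar>"

text \<open>Outside the symmetric set \<open>w\<close> is the identity, so oddness there is
  automatic and can be used without a range condition.\<close>

lemma oriented_perms_iff:
  "w \<in> oriented_perms n \<longleftrightarrow> w permutes ({- int n..int n} - {0}) \<and> (\<forall>i. w (- i) = - w i)"
proof -
  have "w (- i) = - w i" if "w permutes ({- int n..int n} - {0})" "i \<notin> {- int n..int n} - {0}" for i
  proof -
    have "- i \<notin> {- int n..int n} - {0}" using that by auto
    then show ?thesis using permutes_not_in[OF that] permutes_not_in[OF that(1)] by (simp only:)
  qed
  then show ?thesis unfolding oriented_perm_group_def partial_object.simps mem_Collect_eq by blast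
qed

lemma oriented_perms_outside:
  "w \<in> oriented_perms n \<Longrightarrow> i \<notin> {- int n..int n} - {0} \<Longrightarrow> w i = i"
  unfolding oriented_perms_iff by (rule permutes_not_in) blast+

lemma oriented_perms_minus: "w \<in> oriented_perms n \<Longrightarrow> w (- i) = - w i"
  by (simp add: oriented_perms_iff)

lemma oriented_perms_inj: "w \<in> oriented_perms n \<Longrightarrow> w i = w j \<longleftrightarrow> i = j"
  by (auto simp: oriented_perms_iff dest: permutes_inj injD)

lemma oriented_perms_zero: "w \<in> oriented_perms n \<Longrightarrow> w 0 = 0"
  by (simp add: oriented_perms_outside)

lemma oriented_perms_range:
  "w \<in> oriented_perms n \<Longrightarrow> k \<in> {1..n} \<Longrightarrow> w (int k) \<in> {- int n..int n} - {0}"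
  unfolding oriented_perms_iff by (subst permutes_in_image) auto

lemma oriented_perms_nonzero: "w \<in> oriented_perms n \<Longrightarrow> k \<in> {1..n} \<Longrightarrow> w (int k) \<noteq> 0"
  using oriented_perms_range by blast

lemma card_pos_in: "w \<in> oriented_perms n \<Longrightarrow> k \<in> {1..n} \<Longrightarrow> card_pos w k \<in> {1..n}"
  using oriented_perms_range[of w n k] by (auto simp: card_pos_def)

lemma card_pos_bij:
  assumes w: "w \<in> oriented_perms n"
  shows "bij_betw (card_pos w) {1..n} {1..n}"
proof -
  have inj: "inj_on (card_pos w) {1..n}"
  proof (rule inj_onI)
    fix k l assume kl: "k \<in> {1..n}" "l \<in> {1..n}" and "card_pos w k = card_pos w l"
    \<comment> \<open>Equal absolute values give \<open>k = l\<close> or \<open>k = - l\<close> by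
      injectivity and oddness; positivity of both indices excludes the second case.\<close>
    then have "w (int k) = w (int l) \<or> w (int k) = w (- int l)"
      using oriented_perms_minus[OF w] by (auto simp: card_pos_def)
    then show "k = l" using kl by (auto simp: oriented_perms_inj[OF w])
  qed
  moreover have "card_pos w ` {1..n} = {1..n}"
    by (rule endo_inj_surj) (use inj card_pos_in[OF w] in auto)
  ultimately show ?thesis by (simp add: bij_betw_def)
qed

lemma card_pos_surj:
  assumes "w \<in> oriented_perms n" "i \<in> {1..n}"
  obtains k where "k \<in> {1..n}" "i = card_pos w k"
  using card_pos_bij[OF assms(1)] assms(2) unfolding bij_betw_def by blast

lemma oriented_perms_comp:
  assumes "v \<in> oriented_perms n" "w \<in> oriented_perms n"
  shows "v \<circ> w \<in> oriented_perms n"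
  using assms by (auto simp: oriented_perms_iff intro: permutes_compose)

lemma oriented_perms_id: "id \<in> oriented_perms n"
  by (simp add: oriented_perms_iff permutes_id)

text \<open>Oddness moves the sign of a flipped card out of the argument of \<open>v\<close>, so
  that only positive indices remain.\<close>

lemma apply_card_pos:
  assumes v: "v \<in> oriented_perms n" and w: "w \<in> oriented_perms n" and k: "k \<in> {1..n}"
  shows "v (w (int k)) = (if 0 < w (int k) then v (int (card_pos w k)) else - v (int (card_pos w k)))"
proof (cases "0 < w (int k)")
  case False
  then have "w (int k) = - int (card_pos w k)" by (simp add: card_pos_def)
  then show ?thesis using False by (metis oriented_perms_minus[OF v])
qed (simp add: card_pos_def)

lemma card_pos_comp:
  assumes "v \<in> oriented_perms n" "w \<in> oriented_perms n" "k \<in> {1..n}"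
  shows "card_pos (v \<circ> w) k = card_pos v (card_pos w k)"
  using apply_card_pos[OF assms] by (simp add: card_pos_def[of "v \<circ> w"] card_pos_def[of v])

lemma oriented_perms_eqI:
  assumes w: "w \<in> oriented_perms n" and v: "v \<in> oriented_perms n"
    and eq: "\<And>k. k \<in> {1..n} \<Longrightarrow> w (int k) = v (int k)"
  shows "w = v"
proof
  fix i :: int
  have pos: "w (int k) = v (int k)" for k
  proof (cases "k \<in> {1..n}")
    case False
    then have "int k \<notin> {- int n..int n} - {0}" by auto
    then show ?thesis 
      using oriented_perms_outside[OF w] oriented_perms_outside[OF v] by simp
  qed (rule eq)
  show "w i = v i"
  proof (cases "0 \<le> i")
    case True then show ?thesis using pos[of "nat i"] by simp
  next
    case False
    then show ?thesis
      using pos[of "nat (- i)"] oriented_perms_minus[OF w, of i] oriented_perms_minus[OF v, of i] by simp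
  qed
qed

lemma finite_oriented_perms: "finite (oriented_perms n)"
  by (rule finite_subset[OF _ finite_permutations[of "{- int n..int n} - {0}"]])
    (auto simp: oriented_perms_iff)

lemma monoid_oriented_perm_group: "monoid (oriented_perm_group n)"
  by (rule monoidI)
    (use oriented_perms_comp[of _ n] oriented_perms_id[of n] in
      \<open>simp_all add: oriented_perm_group_def fun_eq_iff comp_assoc\<close>)

section \<open>The oriented permutation of a ruffle\<close>

text \<open>The hand of card \<open>k\<close> is read off at its final position. In an odd hand the
  signed positions are negative, so their increase makes the positions themselves decrease, which is
  the reversal of a turned-over hand.\<close>

definition deals :: "nat \<Rightarrow> (nat \<Rightarrow> nat) \<Rightarrow> (int \<Rightarrow> int) \<Rightarrow> bool" where
  "deals n x w \<longleftrightarrow>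
     (\<forall>k\<in>{1..n}. even (x (card_pos w k)) \<longleftrightarrow> 0 < w (int k)) \<and>
     (\<forall>k\<in>{1..n}. \<forall>l\<in>{1..n}. k < l \<longrightarrow> x (card_pos w k) < x (card_pos w l) \<or>
        x (card_pos w k) = x (card_pos w l) \<and> w (int k) < w (int l))"

definition face :: "(nat \<Rightarrow> nat) \<Rightarrow> nat \<Rightarrow> int" where
  "face x i = (if even (x i) then int i else - int i)"

text \<open>
  The linear order in which the stacked hands list the final positions: \<open>dealt_by x i j\<close> says that
  the card ending in position \<open>j\<close> lies no deeper in the original deck than the one ending in \<open>i\<close>.
\<close>

definition dealt_by :: "(nat \<Rightarrow> nat) \<Rightarrow> nat \<Rightarrow> nat \<Rightarrow> bool" where
  "dealt_by x i j \<longleftrightarrow> x j < x i \<or> x j = x i \<and> face x j \<le> face x i"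

lemma deals_even:
  "deals n x w \<Longrightarrow> k \<in> {1..n} \<Longrightarrow> even (x (card_pos w k)) \<longleftrightarrow> 0 < w (int k)"
  unfolding deals_def by (drule conjunct1) (rule bspec)

lemma deals_less:
  "deals n x w \<Longrightarrow> k \<in> {1..n} \<Longrightarrow> l \<in> {1..n} \<Longrightarrow> k < l \<Longrightarrow>
    x (card_pos w k) < x (card_pos w l) \<or>
    x (card_pos w k) = x (card_pos w l) \<and> w (int k) < w (int l)"
  unfolding deals_def by (drule conjunct2) (drule (1) bspec, drule (1) bspec, erule (1) mp)

section \<open>Original positions as ranks in a linear order\<close>

lemma hand_start_eq_card: "hand_start n x j = card {i \<in> {1..n}. x i < j}"
proof (induction j)
  case (Suc j)
  have "{i \<in> {1..n}. x i < Suc j} = {i \<in> {1..n}. x i < j} \<union> {i \<in> {1..n}. x i = j}" by auto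
  then have "card {i \<in> {1..n}. x i < Suc j} = card {i \<in> {1..n}. x i < j} + card {i \<in> {1..n}. x i = j}"
    by (simp add: card_Un_disjoint disjoint_iff)
  then show ?case using Suc by (simp add: hand_start_def hand_size_def)
qed (simp add: hand_start_def)

text \<open>The hands before that of \<open>i\<close> contribute \<open>hand_start\<close>. Within
  its own hand, the cards counted are those ending at positions \<le> \<open>i\<close> if the hand
  is even, and \<ge> \<open>i\<close> if it is odd.\<close>

lemma origin_eq_card:
  assumes i: "i \<in> {1..n}"
  shows "origin n x i = card {j \<in> {1..n}. dealt_by x i j}"
proof -
  let ?H = "{j \<in> {1..n}. x j = x i \<and> face x j \<le> face x i}"
  have "{j \<in> {1..n}. dealt_by x i j} = {j \<in> {1..n}. x j < x i} \<union> ?H"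
    by (auto simp: dealt_by_def)
  then have split: "card {j \<in> {1..n}. dealt_by x i j} = hand_start n x (x i) + card ?H"
    by (simp add: card_Un_disjoint disjoint_iff hand_start_eq_card)
  let ?B = "{k \<in> {1..i}. x k = x i}"
  show ?thesis
  proof (cases "even (x i)")
    case True
    then have "?H = ?B" using i by (auto simp: face_def)
    then show ?thesis using True split by (simp add: origin_def Let_def)
  next
    case False
    then have H: "?H = {k \<in> {i..n}. x k = x i}" using i by (auto simp: face_def)
    \<comment> \<open>Position \<open>i\<close> itself lies in both sets; this overlap is the
      \<open>+ 1\<close> in the definition of \<open>origin\<close> for odd hands.\<close>
    have union: "card ?B + card ?H = card (?B \<union> ?H) + card (?B \<inter> ?H)"
      by (rule card_Un_Int) auto
    have "{k \<in> {1..i}. P k} \<union> {k \<in> {i..n}. P k} = {k \<in> {1..n}. P k}"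
      and "P i \<Longrightarrow> {k \<in> {1..i}. P k} \<inter> {k \<in> {i..n}. P k} = {i}" for P
      using i by auto
    then have "?B \<union> ?H = {k \<in> {1..n}. x k = x i}" "?B \<inter> ?H = {i}"
      unfolding H by blast+
    then have "card ?B + card ?H = hand_size n x (x i) + 1"
      using union by (simp add: hand_size_def)
    then show ?thesis using False split by (simp add: origin_def Let_def)
  qed
qed

lemma face_deals:
  assumes "w \<in> oriented_perms n" "deals n x w" "k \<in> {1..n}"
  shows "face x (card_pos w k) = w (int k)"
  using deals_even[OF assms(2,3)] by (simp add: face_def card_pos_def)

text \<open>The criterion makes \<open>card_pos w\<close> enumerate the positions in the order
  \<open>dealt_by\<close>, so the rank of the \<open>k\<close>-th one is \<open>k\<close>.\<close>

lemma origin_deals: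
  assumes w: "w \<in> oriented_perms n" and d: "deals n x w" and k: "k \<in> {1..n}"
  shows "origin n x (card_pos w k) = k"
proof -
  have iff: "dealt_by x (card_pos w k) (card_pos w l) \<longleftrightarrow> l \<le> k" if l: "l \<in> {1..n}" for l
  proof -
    note less = deals_less[OF d l k] deals_less[OF d k l]
    show ?thesis
      unfolding dealt_by_def face_deals[OF w d k] face_deals[OF w d l]
      using less by (smt (verit, best) linorder_neqE_nat less_imp_le not_le)
  qed
  have "{j \<in> {1..n}. dealt_by x (card_pos w k) j} = card_pos w ` {1..k}"
  proof (intro equalityI subsetI)
    fix j assume j: "j \<in> {j \<in> {1..n}. dealt_by x (card_pos w k) j}"
    then have "j \<in> {1..n}" by simp
    then obtain l where l: "l \<in> {1..n}" "j = card_pos w l" by (rule card_pos_surj[OF w])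
    then show "j \<in> card_pos w ` {1..k}" using j iff[of l] by auto
  next
    fix j assume "j \<in> card_pos w ` {1..k}"
    then obtain l where l: "l \<in> {1..k}" "j = card_pos w l" by auto
    then have "l \<in> {1..n}" using k by auto
    then show "j \<in> {j \<in> {1..n}. dealt_by x (card_pos w k) j}"
      using l iff[of l] card_pos_in[OF w, of l] by auto
  qed
  moreover have "inj_on (card_pos w) {1..k}"
    by (rule inj_on_subset[OF bij_betw_imp_inj_on[OF card_pos_bij[OF w]]]) (use k in auto)
  ultimately show ?thesis
    by (simp add: origin_eq_card[OF card_pos_in[OF w k]] card_image)
qed

section \<open>Existence and uniqueness of the dealt oriented permutation\<close>

lemma dealt_by_refl: "dealt_by x i i"
  by (simp add: dealt_by_def)

lemma dealt_by_linear: "dealt_by x i j \<or> dealt_by x j i"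
  by (auto simp: dealt_by_def)

lemma dealt_by_trans: "dealt_by x i j \<Longrightarrow> dealt_by x j k \<Longrightarrow> dealt_by x i k"
  unfolding dealt_by_def by linarith

lemma dealt_by_antisym: "dealt_by x i j \<Longrightarrow> dealt_by x j i \<Longrightarrow> i = j"
  by (cases "x i = x j") (auto simp: dealt_by_def face_def split: if_splits)

lemma origin_mono:
  assumes ij: "i \<in> {1..n}" "j \<in> {1..n}" "dealt_by x i j"
  shows "origin n x j \<le> origin n x i"
  unfolding origin_eq_card[OF ij(1)] origin_eq_card[OF ij(2)]
  by (rule card_mono) (use dealt_by_trans[OF ij(3)] in auto)

text \<open>Ranks in a finite linear order are distinct, and each is at least 1 because an element
  counts itself.\<close>

lemma origin_bij: "bij_betw (origin n x) {1..n} {1..n}"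
proof -
  have less: "origin n x j < origin n x i"
    if ij: "i \<in> {1..n}" "j \<in> {1..n}" "i \<noteq> j" "dealt_by x i j" for i j
    unfolding origin_eq_card[OF ij(1)] origin_eq_card[OF ij(2)]
  proof (rule psubset_card_mono)
    \<comment> \<open>The inclusion of initial segments is strict because \<open>i\<close> belongs
      to its own segment but not to that of \<open>j\<close>.\<close>
    have "\<not> dealt_by x j i" using dealt_by_antisym ij by blast
    then show "{k \<in> {1..n}. dealt_by x j k} \<subset> {k \<in> {1..n}. dealt_by x i k}"
      using dealt_by_trans[OF ij(4)] dealt_by_refl[of x i] ij by blast
  qed simp
  have inj: "inj_on (origin n x) {1..n}"
  proof (rule inj_onI, rule ccontr)
    fix i j assume ij: "i \<in> {1..n}" "j \<in> {1..n}" "origin n x i = origin n x j" "i \<noteq> j"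
    then show False using less[of i j] less[of j i] dealt_by_linear[of x i j] by auto
  qed
  moreover have "origin n x ` {1..n} = {1..n}"
  proof (rule endo_inj_surj)
    show "origin n x ` {1..n} \<subseteq> {1..n}"
    proof
      fix m assume "m \<in> origin n x ` {1..n}"
      then obtain i where i: "i \<in> {1..n}" "m = origin n x i" by auto
      have "{i} \<subseteq> {j \<in> {1..n}. dealt_by x i j}" using i by (auto simp: dealt_by_refl)
      then have "card {i} \<le> card {j \<in> {1..n}. dealt_by x i j}" by (intro card_mono) auto
      moreover have "card {j \<in> {1..n}. dealt_by x i j} \<le> card {1..n}" by (intro card_mono) auto
      ultimately show "m \<in> {1..n}" using i by (simp add: origin_eq_card[OF i(1)])
    qed
  qed (use inj in auto)
  ultimately show ?thesis by (simp add: bij_betw_def)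
qed

text \<open>The witness inverts \<open>origin\<close>: the card from original position
  \<open>k\<close> ends at \<open>p k\<close>, with the sign given by \<open>face\<close>.\<close>

lemma deals_exists: "\<exists>w \<in> oriented_perms n. deals n x w"
proof -
  define p where "p = inv_into {1..n} (origin n x)"
  let ?D = "{- int n..int n} - {0}"
  \<comment> \<open>The factor \<open>sgn i\<close> extends the map from positive indices to an odd
    one.\<close>
  define w where "w i = (if i \<in> ?D then sgn i * face x (p (nat \<bar>i\<bar>)) else i)" for i
  have p_in: "p k \<in> {1..n}" and origin_p: "origin n x (p k) = k" if "k \<in> {1..n}" for k
    using that bij_betw_inv_into[OF origin_bij[of n x]] bij_betw_inv_into_right[OF origin_bij[of n x]]
    unfolding p_def by (auto simp: bij_betw_def)
  have abs_w: "\<bar>w i\<bar> = int (p (nat \<bar>i\<bar>))" if "i \<in> ?D" for i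
    using that by (auto simp: w_def face_def abs_mult sgn_if)
  have w_minus: "w (- i) = - w i" for i by (auto simp: w_def sgn_minus)
  have in_D: "nat \<bar>i\<bar> \<in> {1..n}" if "i \<in> ?D" for i using that by auto
  have w_D: "w i \<in> ?D" if "i \<in> ?D" for i
    using abs_w[OF that] p_in[OF in_D[OF that]] by auto
  have inj: "inj_on w ?D"
  proof (rule inj_onI)
    fix i j assume ij: "i \<in> ?D" "j \<in> ?D" "w i = w j"
    then have "p (nat \<bar>i\<bar>) = p (nat \<bar>j\<bar>)" using abs_w[of i] abs_w[of j] by simp
    then have "nat \<bar>i\<bar> = nat \<bar>j\<bar>" using origin_p in_D ij(1,2) by metis
    \<comment> \<open>For \<open>i = - j\<close> oddness would give \<open>w i = - w i\<close>,
      hence \<open>w i = 0\<close>, which is not in \<open>?D\<close>.\<close>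
    moreover have "i \<noteq> - j" using w_minus[of j] ij w_D[of i] by auto
    ultimately show "i = j" by auto
  qed
  have "w ` ?D = ?D" by (rule endo_inj_surj) (use inj w_D in auto)
  then have "w permutes ?D"
    using inj by (intro bij_imp_permutes) (auto simp: bij_betw_def w_def)
  then have w: "w \<in> oriented_perms n" by (simp add: oriented_perms_iff w_minus)
  have w_pos: "w (int k) = face x (p k)" and pos_eq: "card_pos w k = p k" if "k \<in> {1..n}" for k
    using that abs_w[of "int k"] by (auto simp: w_def card_pos_def)
  have "deals n x w"
    unfolding deals_def
  proof (intro conjI ballI impI)
    fix k assume "k \<in> {1..n}"
    then show "even (x (card_pos w k)) \<longleftrightarrow> 0 < w (int k)"
      using p_in[of k] by (auto simp: w_pos pos_eq face_def)
  next
    fix k l assume kl: "k \<in> {1..n}" "l \<in> {1..n}" "k < l"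
    \<comment> \<open>Otherwise monotonicity of \<open>origin\<close> would give
      \<open>l \<le> k\<close>. The negation of \<open>dealt_by\<close> is exactly the strict
      lexicographic increase required.\<close>
    have "\<not> dealt_by x (p k) (p l)"
      using origin_mono[OF p_in[OF kl(1)] p_in[OF kl(2)], of x] origin_p[OF kl(1)] origin_p[OF kl(2)] kl(3)
      by auto
    then show "x (card_pos w k) < x (card_pos w l) \<or>
        x (card_pos w k) = x (card_pos w l) \<and> w (int k) < w (int l)"
      using kl by (auto simp: dealt_by_def w_pos pos_eq)
  qed
  then show ?thesis using w by blast
qed

text \<open>Uniqueness for the description operator: every card is the origin of some position,
  which fixes all values on positive indices, and oddness fixes the others.\<close>

lemma orientedruffle_deals:
  assumes w: "w \<in> oriented_perms n" and d: "deals n x w"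
  shows "orientedruffle n (a, x) = w"
proof -
  have w_origin: "w (int (origin n x i)) = face x i" if "i \<in> {1..n}" for i
  proof -
    obtain k where "k \<in> {1..n}" "i = card_pos w k" by (rule card_pos_surj[OF w \<open>i \<in> {1..n}\<close>])
    then show ?thesis by (simp add: origin_deals[OF w d] face_deals[OF w d])
  qed
  have "(THE w. w \<in> oriented_perms n \<and> (\<forall>i\<in>{1..n}. w (int (origin n x i)) = face x i)) = w"
  proof (rule the_equality)
    fix v assume v: "v \<in> oriented_perms n \<and> (\<forall>i\<in>{1..n}. v (int (origin n x i)) = face x i)"
    show "v = w"
    proof (rule oriented_perms_eqI)
      fix k assume "k \<in> {1..n}"
      then have "k \<in> origin n x ` {1..n}" using origin_bij[of n x] by (simp add: bij_betw_def)
      then show "v (int k) = w (int k)" using v w_origin by auto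
    qed (use v w in auto)
  qed (use w w_origin in auto)
  then show ?thesis by (simp add: orientedruffle_def face_def)
qed

lemma orientedruffle_eq_iff:
  "orientedruffle n (a, x) = w \<longleftrightarrow> w \<in> oriented_perms n \<and> deals n x w"
  using deals_exists[of n x] orientedruffle_deals[of _ n x a] by blast

lemma orientedruffle_in: "orientedruffle n (a, x) \<in> oriented_perms n"
  and deals_orientedruffle: "deals n x (orientedruffle n (a, x))"
  using orientedruffle_eq_iff[of n a x "orientedruffle n (a, x)"] by simp_all

section \<open>The ruffle monoid\<close>

text \<open>An entry of a product of ruffles as a number with leading digit \<open>p\<close> and
  base-\<open>b\<close> digit \<open>q\<close>, the latter reflected when \<open>p\<close> is odd.
  For \<open>q < b\<close> the subtraction does not truncate.\<close>

definition interleave :: "nat \<Rightarrow> nat \<Rightarrow> nat \<Rightarrow> nat" where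
  "interleave b p q = (if even p then b * p + q else b * p + (b - 1 - q))"

lemma interleave_bounds: "q < b \<Longrightarrow> b * p \<le> interleave b p q \<and> interleave b p q < b * (p + 1)"
  by (auto simp: interleave_def)

lemma interleave_less:
  assumes "p < p'" "q < b" "q' < b"
  shows "interleave b p q < interleave b p' q'"
proof -
  have "b * (p + 1) \<le> b * p'" using assms by (intro mult_le_mono2) simp
  then show ?thesis using interleave_bounds[OF assms(2), of p] interleave_bounds[OF assms(3), of p'] by linarith
qed

lemma interleave_inject:
  assumes eq: "interleave b p q = interleave b p' q'" and q: "q < b" "q' < b"
  shows "p = p'" "q = q'"
proof -
  show p: "p = p'"
    using interleave_less[of p p' q b q'] interleave_less[of p' p q' b q] assms
    by (cases p p' rule: linorder_cases) auto
  show "q = q'" using eq q unfolding p by (auto simp: interleave_def split: if_splits)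
qed

lemma interleave_less_mult:
  assumes "p < a" "q < b"
  shows "interleave b p q < a * b"
proof -
  have "b * (p + 1) \<le> b * a" using assms by (intro mult_le_mono2) simp
  then show ?thesis using interleave_bounds[OF assms(2), of p] by (simp add: mult.commute)
qed

lemma even_interleave: "q < b \<Longrightarrow> even (interleave b p q) \<longleftrightarrow> (even p \<longleftrightarrow> even q)"
  by (cases "even p") (auto simp: interleave_def)

lemma interleave_assoc:
  assumes q: "q < b" and r: "r < c"
  shows "interleave c (interleave b p q) r = interleave (b * c) p (interleave c q r)"
proof -
  \<comment> \<open>The names \<open>s\<close> and \<open>t\<close> stand for the reflected digits
    \<open>b - 1 - q\<close> and \<open>c - 1 - r\<close>. Reflecting a two-digit block as a whole
    reflects each of its digits, as the next equations record.\<close>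
  obtain s where b: "b = q + 1 + s" using q less_iff_Suc_add[of q b] by auto
  obtain t where c: "c = r + 1 + t" using r less_iff_Suc_add[of r c] by auto
  have "b * c - 1 - (c * q + r) = c * s + t" "b * c - 1 - (c * q + t) = c * s + r"
    unfolding b c by (simp_all add: algebra_simps)
  then show ?thesis
    using even_interleave[OF q, of p]
    by (auto simp: interleave_def b[symmetric] c[symmetric])
      (auto simp: b c algebra_simps)
qed

section \<open>Products of ruffles and the homomorphism property\<close>

lemma ruffle_eq_card_pos: "ruffle n r = card_pos (orientedruffle n r)"
  by (simp add: ruffle_def card_pos_def fun_eq_iff)

text \<open>Evaluating at the place where the second ruffle puts card \<open>k\<close> cancels the
  inverse permutation in \<open>list_act\<close>. Since every position has this form, the product is
  determined by this rule.\<close>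

lemma ruffle_mult_at_card_pos:
  assumes k: "k \<in> {1..n}"
  shows "snd (ruffle_mult n (a, x) (b, y)) (card_pos (orientedruffle n (b, y)) k) =
    interleave b (x k) (y (card_pos (orientedruffle n (b, y)) k))"
proof -
  let ?\<sigma> = "card_pos (orientedruffle n (b, y))"
  have "inv_into {1..n} ?\<sigma> (?\<sigma> k) = k"
    using card_pos_bij[OF orientedruffle_in] k by (meson bij_betw_imp_inj_on inv_into_f_f)
  moreover have "?\<sigma> k \<in> {1..n}" by (rule card_pos_in[OF orientedruffle_in k])
  ultimately show ?thesis
    by (simp add: ruffle_mult_def ruffle_eq_card_pos list_act_def interleave_def Let_def)
qed

lemma fst_ruffle_mult: "fst (ruffle_mult n r s) = fst r * fst s"
  by (simp add: ruffle_mult_def split_beta Let_def)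

lemma ruffle_mult_extensional: "snd (ruffle_mult n r s) \<in> extensional {1..n}"
  by (simp add: ruffle_mult_def split_beta Let_def)

lemma ruffles_iff:
  "(a, x) \<in> ruffles n \<longleftrightarrow> 1 \<le> a \<and> x \<in> extensional {1..n} \<and> (\<forall>i\<in>{1..n}. x i < a)"
  by (auto simp: ruffles_def PiE_iff)

lemma ruffle_mult_in_ruffles:
  assumes "(a, x) \<in> ruffles n" "(b, y) \<in> ruffles n"
  shows "ruffle_mult n (a, x) (b, y) \<in> ruffles n"
proof -
  obtain z where z: "ruffle_mult n (a, x) (b, y) = (a * b, z)"
    using fst_ruffle_mult[of n "(a, x)" "(b, y)"] by (metis fst_conv prod.collapse)
  have "z i < a * b" if i: "i \<in> {1..n}" for i
  proof -
    obtain k where k: "k \<in> {1..n}" "i = card_pos (orientedruffle n (b, y)) k"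
      by (rule card_pos_surj[OF orientedruffle_in i])
    then have "z i = interleave b (x k) (y i)"
      using ruffle_mult_at_card_pos[OF k(1), of a x b y] by (simp add: z)
    then show ?thesis
      using assms k(1) i by (simp add: ruffles_iff interleave_less_mult)
  qed
  moreover have "z \<in> extensional {1..n}"
    using ruffle_mult_extensional[of n "(a, x)" "(b, y)"] by (simp add: z)
  ultimately show ?thesis using assms by (simp add: z ruffles_iff)
qed

text \<open>The product list is checked against the criterion \<open>deals\<close> for the
  composite, which applies the first ruffle first.\<close>

lemma orientedruffle_ruffle_mult:
  assumes "(b, y) \<in> ruffles n"
  shows "orientedruffle n (ruffle_mult n (a, x) (b, y)) =
    orientedruffle n (b, y) \<circ> orientedruffle n (a, x)"
proof -
  let ?v = "orientedruffle n (b, y)" and ?w = "orientedruffle n (a, x)"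
  define z where "z = snd (ruffle_mult n (a, x) (b, y))"
  note v = orientedruffle_in[of n b y] and w = orientedruffle_in[of n a x]
  note dv = deals_orientedruffle[of n y b] and dw = deals_orientedruffle[of n x a]
  note pos_in = card_pos_in[OF w]
  have z: "z (card_pos (?v \<circ> ?w) k) =
      interleave b (x (card_pos ?w k)) (y (card_pos ?v (card_pos ?w k)))" if "k \<in> {1..n}" for k
    unfolding card_pos_comp[OF v w that] z_def by (rule ruffle_mult_at_card_pos[OF pos_in[OF that]])
  have y: "y (card_pos ?v (card_pos ?w k)) < b" if "k \<in> {1..n}" for k
    using assms card_pos_in[OF v pos_in[OF that]] by (simp only: ruffles_iff)
  have "deals n z (?v \<circ> ?w)"
    unfolding deals_def
  proof (intro conjI ballI impI)
    fix k assume k: "k \<in> {1..n}"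
    \<comment> \<open>Parities of hands and signs of cards combine by the same rule: even,
      respectively positive, exactly when the two factors agree.\<close>
    have "even (z (card_pos (?v \<circ> ?w) k)) \<longleftrightarrow>
        (0 < ?w (int k) \<longleftrightarrow> 0 < ?v (int (card_pos ?w k)))"
      unfolding z[OF k] even_interleave[OF y[OF k]] deals_even[OF dw k] deals_even[OF dv pos_in[OF k]] ..
    also have "\<dots> \<longleftrightarrow> 0 < (?v \<circ> ?w) (int k)"
      using apply_card_pos[OF v w k] oriented_perms_nonzero[OF v pos_in[OF k]] by auto
    finally show "even (z (card_pos (?v \<circ> ?w) k)) \<longleftrightarrow> 0 < (?v \<circ> ?w) (int k)" .
  next
    fix k l assume k: "k \<in> {1..n}" and l: "l \<in> {1..n}" and kl: "k < l"
    let ?i = "card_pos ?w k" and ?j = "card_pos ?w l"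
    consider (less) "x ?i < x ?j" | (eq) "x ?i = x ?j" "?w (int k) < ?w (int l)"
      using deals_less[OF dw k l kl] by blast
    then show "z (card_pos (?v \<circ> ?w) k) < z (card_pos (?v \<circ> ?w) l) \<or>
      z (card_pos (?v \<circ> ?w) k) = z (card_pos (?v \<circ> ?w) l) \<and>
      (?v \<circ> ?w) (int k) < (?v \<circ> ?w) (int l)"
    proof cases
      \<comment> \<open>Different hands in the first ruffle: the leading digit decides.\<close>
      case less
      then show ?thesis unfolding z[OF k] z[OF l] using interleave_less y[OF k] y[OF l] by blast
    next
      case eq
      show ?thesis
      proof (cases "even (x ?i)")
        \<comment> \<open>An even first hand keeps the order of its cards, so the criterion for
          \<open>?v\<close> applies to \<open>?i < ?j\<close> directly.\<close>
        case True
        then have pos: "0 < ?w (int k)" "0 < ?w (int l)"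
          using deals_even[OF dw k] deals_even[OF dw l] eq(1) by auto
        then have "?i < ?j" using eq(2) by (simp add: card_pos_def)
        then show ?thesis
          using deals_less[OF dv pos_in[OF k] pos_in[OF l]] True pos
            apply_card_pos[OF v w k] apply_card_pos[OF v w l]
          unfolding z[OF k] z[OF l] eq(1) by (simp add: interleave_def eq(1))
      next
        \<comment> \<open>An odd first hand reverses its cards. The criterion for \<open>?v\<close>
          then compares them the other way round, and both the reflected digit and the sign change
          reverse that comparison again.\<close>
        case False
        then have neg: "?w (int k) < 0" "?w (int l) < 0"
          using deals_even[OF dw k] deals_even[OF dw l] eq(1)
            oriented_perms_nonzero[OF w k] oriented_perms_nonzero[OF w l] by force+
        then have "?j < ?i" using eq(2) by (simp add: card_pos_def)
        then show ?thesis
          using deals_less[OF dv pos_in[OF l] pos_in[OF k]] False neg y[OF k] y[OF l]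
            apply_card_pos[OF v w k] apply_card_pos[OF v w l]
          unfolding z[OF k] z[OF l] eq(1) by (auto simp: interleave_def eq(1))
      qed
    qed
  qed
  then have "orientedruffle n (a * b, z) = ?v \<circ> ?w"
    by (intro orientedruffle_deals oriented_perms_comp v w)
  moreover have "ruffle_mult n (a, x) (b, y) = (a * b, z)"
    using fst_ruffle_mult[of n "(a, x)" "(b, y)"] by (simp add: z_def prod_eq_iff)
  ultimately show ?thesis by simp
qed

lemma orientedruffle_one: "orientedruffle n (1, \<lambda>i\<in>{1..n}. 0) = id"
  by (rule orientedruffle_deals[OF oriented_perms_id]) (auto simp: deals_def card_pos_def)

lemma ruffle_mult_assoc:
  assumes r: "(a, x) \<in> ruffles n" "(b, y) \<in> ruffles n" "(c, z) \<in> ruffles n"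
  shows "ruffle_mult n (ruffle_mult n (a, x) (b, y)) (c, z) =
    ruffle_mult n (a, x) (ruffle_mult n (b, y) (c, z))"
proof (rule prod_eqI)
  let ?u = "orientedruffle n (c, z)" and ?v = "orientedruffle n (b, y)"
  define p where "p = snd (ruffle_mult n (a, x) (b, y))"
  define q where "q = snd (ruffle_mult n (b, y) (c, z))"
  have xy: "ruffle_mult n (a, x) (b, y) = (a * b, p)"
    using fst_ruffle_mult[of n "(a, x)" "(b, y)"] by (simp add: p_def prod_eq_iff)
  have yz: "ruffle_mult n (b, y) (c, z) = (b * c, q)"
    using fst_ruffle_mult[of n "(b, y)" "(c, z)"] by (simp add: q_def prod_eq_iff)
  show "snd (ruffle_mult n (ruffle_mult n (a, x) (b, y)) (c, z)) =
    snd (ruffle_mult n (a, x) (ruffle_mult n (b, y) (c, z)))"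
  proof (rule extensionalityI[OF ruffle_mult_extensional ruffle_mult_extensional])
    fix i assume i: "i \<in> {1..n}"
    \<comment> \<open>Position \<open>i\<close> is traced back through the third ruffle to
      \<open>j\<close> and through the second to \<open>k\<close>; there both sides are nested
      interleavings of \<open>x k\<close>, \<open>y j\<close> and \<open>z i\<close>.\<close>
    obtain j where j: "j \<in> {1..n}" "i = card_pos ?u j"
      by (rule card_pos_surj[OF orientedruffle_in i])
    obtain k where k: "k \<in> {1..n}" "j = card_pos ?v k"
      by (rule card_pos_surj[OF orientedruffle_in j(1)])
    have "card_pos (orientedruffle n (b * c, q)) k = i"
      unfolding yz[symmetric] orientedruffle_ruffle_mult[OF r(3)]
      using card_pos_comp[OF orientedruffle_in orientedruffle_in k(1)] j k by simp
    then have "snd (ruffle_mult n (a, x) (b * c, q)) i = interleave (b * c) (x k) (q i)"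
      using ruffle_mult_at_card_pos[OF k(1), of a x "b * c" q] by simp
    also have "q i = interleave c (y j) (z i)"
      unfolding q_def j(2) by (rule ruffle_mult_at_card_pos[OF j(1)])
    also have "interleave (b * c) (x k) (interleave c (y j) (z i)) =
        interleave c (interleave b (x k) (y j)) (z i)"
      by (rule interleave_assoc[symmetric]) (use r i j in \<open>auto simp: ruffles_iff\<close>)
    also have "interleave b (x k) (y j) = p j"
      unfolding p_def k(2) by (rule ruffle_mult_at_card_pos[OF k(1), symmetric])
    also have "interleave c (p j) (z i) = snd (ruffle_mult n (a * b, p) (c, z)) i"
      unfolding j(2) by (rule ruffle_mult_at_card_pos[OF j(1), symmetric])
    finally show "snd (ruffle_mult n (ruffle_mult n (a, x) (b, y)) (c, z)) i =
      snd (ruffle_mult n (a, x) (ruffle_mult n (b, y) (c, z))) i"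
      unfolding xy yz by simp
  qed
qed (simp add: fst_ruffle_mult)

lemma ruffle_mult_one_left:
  assumes "(b, y) \<in> ruffles n"
  shows "ruffle_mult n (1, \<lambda>i\<in>{1..n}. 0) (b, y) = (b, y)"
proof (rule prod_eqI)
  show "snd (ruffle_mult n (1, \<lambda>i\<in>{1..n}. 0) (b, y)) = snd (b, y)"
  proof (rule extensionalityI[OF ruffle_mult_extensional])
    fix i assume i: "i \<in> {1..n}"
    obtain k where k: "k \<in> {1..n}" "i = card_pos (orientedruffle n (b, y)) k"
      by (rule card_pos_surj[OF orientedruffle_in i])
    then show "snd (ruffle_mult n (1, \<lambda>i\<in>{1..n}. 0) (b, y)) i = snd (b, y) i"
      using ruffle_mult_at_card_pos[OF k(1), of 1 "\<lambda>i\<in>{1..n}. 0" b y]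
      by (simp add: interleave_def)
  qed (use assms in \<open>simp add: ruffles_iff\<close>)
qed (simp add: fst_ruffle_mult)

lemma ruffle_mult_one_right:
  assumes "(a, x) \<in> ruffles n"
  shows "ruffle_mult n (a, x) (1, \<lambda>i\<in>{1..n}. 0) = (a, x)"
proof (rule prod_eqI)
  show "snd (ruffle_mult n (a, x) (1, \<lambda>i\<in>{1..n}. 0)) = snd (a, x)"
  proof (rule extensionalityI[OF ruffle_mult_extensional])
    fix i assume i: "i \<in> {1..n}"
    have "card_pos (orientedruffle n (1, \<lambda>i\<in>{1..n}. 0)) i = i"
      unfolding orientedruffle_one by (simp add: card_pos_def)
    then show "snd (ruffle_mult n (a, x) (1, \<lambda>i\<in>{1..n}. 0)) i = snd (a, x) i"
      using ruffle_mult_at_card_pos[OF i, of a x 1 "\<lambda>i\<in>{1..n}. 0"] i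
      by (simp add: interleave_def)
  qed (use assms in \<open>simp add: ruffles_iff\<close>)
qed (simp add: fst_ruffle_mult)

lemma monoid_ruffle_monoid: "monoid (ruffle_monoid n)"
proof (rule monoidI)
  show "\<one>\<^bsub>ruffle_monoid n\<^esub> \<in> carrier (ruffle_monoid n)"
    by (simp add: ruffle_monoid_def ruffles_iff)
qed (auto simp: ruffle_monoid_def ruffle_mult_in_ruffles ruffle_mult_assoc
    ruffle_mult_one_left[simplified] ruffle_mult_one_right[simplified])

lemma monoid_hom_orientedruffle:
  "orientedruffle n \<in> monoid_hom (ruffle_monoid n) (oriented_perm_group n)"
  unfolding monoid_hom_def hom_def
  using orientedruffle_one[of n]
  by (auto simp: ruffle_monoid_def orientedruffle_ruffle_mult orientedruffle_in)
    (simp_all add: oriented_perm_group_def)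

section \<open>Hand classes and the products of their sums\<close>

definition hand_class :: "nat \<Rightarrow> nat \<Rightarrow> (nat \<times> (nat \<Rightarrow> nat)) set" where
  "hand_class n a = {a} \<times> ({1..n} \<rightarrow>\<^sub>E {0..<a})"

lemma finite_hand_class: "finite (hand_class n a)"
  by (simp add: hand_class_def finite_PiE)

lemma card_hand_class: "card (hand_class n a) = a ^ n"
  by (simp add: hand_class_def card_cartesian_product card_PiE)

lemma hand_class_subset: "1 \<le> a \<Longrightarrow> hand_class n a \<subseteq> ruffles n"
  by (auto simp: hand_class_def ruffles_def)

lemma level_sets_hand: "level_sets (ruffle_monoid n) hand = hand_class n ` {1..}"
proof -
  have level: "{r \<in> carrier (ruffle_monoid n). hand r = a} = hand_class n a" if "1 \<le> a" for a
    using that by (auto simp: ruffle_monoid_def ruffles_def hand_def hand_class_def)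
  have "hand ` ruffles n = {1..}"
  proof (intro equalityI subsetI)
    fix a :: nat assume "a \<in> {1..}"
    then have "(a, \<lambda>i\<in>{1..n}. 0) \<in> ruffles n" by (auto simp: ruffles_iff)
    then show "a \<in> hand ` ruffles n" by (force simp: hand_def)
  qed (auto simp: ruffles_def hand_def)
  then have "(\<lambda>a. {r \<in> carrier (ruffle_monoid n). hand r = a}) ` hand ` ruffles n = hand_class n ` {1..}"
    using level by (auto simp: image_iff)
  then show ?thesis by (simp add: level_sets_def image_image ruffle_monoid_def)
qed

text \<open>Injectivity suffices, since both sides have (ab)^n elements.\<close>

lemma bij_betw_ruffle_mult:
  assumes a: "1 \<le> a" and b: "1 \<le> b"
  shows "bij_betw (\<lambda>(r, s). ruffle_mult n r s) (hand_class n a \<times> hand_class n b) (hand_class n (a * b))"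
proof -
  let ?m = "\<lambda>(r, s). ruffle_mult n r s"
  let ?X = "hand_class n a \<times> hand_class n b"
  have in_class: "(c, x) \<in> hand_class n d \<longleftrightarrow> c = d \<and> (c, x) \<in> ruffles n" if "1 \<le> d" for c d x
    using that by (auto simp: hand_class_def ruffles_def)
  have inj: "inj_on ?m ?X"
  proof (rule inj_onI)
    fix p q assume p: "p \<in> ?X" and q: "q \<in> ?X" and eq: "?m p = ?m q"
    obtain x y where p_eq: "p = ((a, x), (b, y))" using p by (auto simp: hand_class_def)
    obtain x' y' where q_eq: "q = ((a, x'), (b, y'))" using q by (auto simp: hand_class_def)
    have r: "(a, x) \<in> ruffles n" "(b, y) \<in> ruffles n" "(a, x') \<in> ruffles n" "(b, y') \<in> ruffles n"
      using p q in_class[OF a] in_class[OF b] by (auto simp: p_eq q_eq)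
    let ?v = "orientedruffle n (b, y)" and ?v' = "orientedruffle n (b, y')"
    have eq': "snd (ruffle_mult n (a, x) (b, y)) = snd (ruffle_mult n (a, x') (b, y'))"
      using eq by (simp add: p_eq q_eq)
    have y: "y = y'"
    proof (rule extensionalityI)
      fix i assume i: "i \<in> {1..n}"
      \<comment> \<open>The cards landing at \<open>i\<close> may differ until \<open>y = y'\<close>
        is known, so \<open>k\<close> and \<open>l\<close> are kept apart; the last digit at
        \<open>i\<close> still determines \<open>y i\<close>.\<close>
      obtain k where k: "k \<in> {1..n}" "i = card_pos ?v k" by (rule card_pos_surj[OF orientedruffle_in i])
      obtain l where l: "l \<in> {1..n}" "i = card_pos ?v' l" by (rule card_pos_surj[OF orientedruffle_in i])
      have "interleave b (x k) (y i) = interleave b (x' l) (y' i)"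
        using ruffle_mult_at_card_pos[OF k(1), of a x b y] ruffle_mult_at_card_pos[OF l(1), of a x' b y']
          eq' k(2) l(2) by simp
      then show "y i = y' i" by (rule interleave_inject) (use r i in \<open>auto simp: ruffles_iff\<close>)
    qed (use r in \<open>auto simp: ruffles_iff\<close>)
    \<comment> \<open>Now the second ruffles agree, so the leading digits at the same position
      belong to the same card.\<close>
    have "x = x'"
    proof (rule extensionalityI)
      fix k assume k: "k \<in> {1..n}"
      have "card_pos ?v k \<in> {1..n}" by (rule card_pos_in[OF orientedruffle_in k])
      then have "y (card_pos ?v k) < b" using r by (simp only: ruffles_iff)
      moreover have "interleave b (x k) (y (card_pos ?v k)) = interleave b (x' k) (y (card_pos ?v k))"
        using ruffle_mult_at_card_pos[OF k, of a x b y] ruffle_mult_at_card_pos[OF k, of a x' b y] eq'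
        by (simp add: y)
      ultimately show "x k = x' k" using interleave_inject by blast
    qed (use r in \<open>auto simp: ruffles_iff\<close>)
    then show "p = q" using y by (simp add: p_eq q_eq)
  qed
  have "?m ` ?X \<subseteq> hand_class n (a * b)"
  proof
    fix t assume "t \<in> ?m ` ?X"
    then obtain x y where xy: "(a, x) \<in> hand_class n a" "(b, y) \<in> hand_class n b"
      and t: "t = ruffle_mult n (a, x) (b, y)" by (auto simp: hand_class_def)
    have "t \<in> ruffles n"
      unfolding t using xy in_class[OF a] in_class[OF b] by (intro ruffle_mult_in_ruffles) auto
    moreover have "fst t = a * b" by (simp add: t fst_ruffle_mult)
    ultimately show "t \<in> hand_class n (a * b)" using in_class[of "a * b"] a b by (cases t) auto
  qed
  moreover have "card (?m ` ?X) = card (hand_class n (a * b))"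
    by (simp add: card_image[OF inj] card_cartesian_product card_hand_class power_mult_distrib)
  ultimately have "?m ` ?X = hand_class n (a * b)"
    by (rule card_subset_eq[OF finite_hand_class])
  then show ?thesis using inj by (simp add: bij_betw_def)
qed

text \<open>The parameter \<open>f\<close> covers both the class sums of \<open>hand\<close>
  (\<open>f = id\<close>) and their images under a homomorphism.\<close>

definition hand_sum :: "nat \<Rightarrow> (nat \<times> (nat \<Rightarrow> nat) \<Rightarrow> 'b) \<Rightarrow> nat \<Rightarrow> ('b \<Rightarrow>\<^sub>0 rat)" where
  "hand_sum n f a = (\<Sum>r\<in>hand_class n a. Poly_Mapping.single (f r) 1)"

lemma malg_mult_hand_sum:
  assumes f: "f \<in> hom (ruffle_monoid n) N" and a: "1 \<le> a" and b: "1 \<le> b"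
  shows "malg_mult N (hand_sum n f a) (hand_sum n f b) = hand_sum n f (a * b)"
proof -
  have "malg_mult N (hand_sum n f a) (hand_sum n f b) =
      (\<Sum>r\<in>hand_class n a. \<Sum>s\<in>hand_class n b. Poly_Mapping.single (f r \<otimes>\<^bsub>N\<^esub> f s) 1)"
    by (simp add: hand_sum_def malg_mult_sum_single)
  also have "\<dots> = (\<Sum>r\<in>hand_class n a. \<Sum>s\<in>hand_class n b. Poly_Mapping.single (f (ruffle_mult n r s)) 1)"
  proof (intro sum.cong refl)
    fix r s assume "r \<in> hand_class n a" "s \<in> hand_class n b"
    then have "r \<in> carrier (ruffle_monoid n)" "s \<in> carrier (ruffle_monoid n)"
      using hand_class_subset[OF a] hand_class_subset[OF b] by (auto simp: ruffle_monoid_def)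
    from hom_mult[OF f this]
    show "Poly_Mapping.single (f r \<otimes>\<^bsub>N\<^esub> f s) (1::rat) = Poly_Mapping.single (f (ruffle_mult n r s)) 1"
      by (simp add: ruffle_monoid_def)
  qed
  also have "\<dots> = (\<Sum>p\<in>hand_class n a \<times> hand_class n b.
      Poly_Mapping.single (f ((\<lambda>(r, s). ruffle_mult n r s) p)) 1)"
    by (simp add: sum.cartesian_product split_beta)
  also have "\<dots> = hand_sum n f (a * b)"
    unfolding hand_sum_def by (rule sum.reindex_bij_betw[OF bij_betw_ruffle_mult[OF a b]])
  finally show ?thesis .
qed

lemma image_class_sums_hand: "image_class_sums (ruffle_monoid n) hand f = hand_sum n f ` {1..}"
  by (simp add: image_class_sums_def level_sets_hand hand_sum_def image_image)

lemma malg_mult_in_span_hand_sums: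
  assumes "f \<in> hom (ruffle_monoid n) N"
    and "p \<in> malg.span (hand_sum n f ` {1..})" "q \<in> malg.span (hand_sum n f ` {1..})"
  shows "malg_mult N p q \<in> malg.span (hand_sum n f ` {1..})"
  using _ assms(2,3)
  by (rule malg_mult_in_span) (auto simp: malg_mult_hand_sum[OF assms(1)] intro!: malg.span_base imageI)

lemma malg_mult_commute_hand_sums:
  assumes "f \<in> hom (ruffle_monoid n) N"
    and "p \<in> malg.span (hand_sum n f ` {1..})" "q \<in> malg.span (hand_sum n f ` {1..})"
  shows "malg_mult N p q = malg_mult N q p"
  using _ assms(2,3)
  by (rule malg_mult_commute_on_span) (auto simp: malg_mult_hand_sum[OF assms(1)] mult.commute)

lemma finite_level_sets_hand: "finite_level_sets (ruffle_monoid n) hand"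
  by (auto simp: finite_level_sets_def level_sets_hand finite_hand_class)

lemma lumping_hand: "lumping (ruffle_monoid n) hand"
proof (rule lumpingI[OF monoid_ruffle_monoid finite_level_sets_hand])
  have sums: "class_sums (ruffle_monoid n) hand = hand_sum n id ` {1..}"
    by (simp add: class_sums_def level_sets_hand hand_sum_def image_image)
  have "id \<in> hom (ruffle_monoid n) (ruffle_monoid n)"
    by (simp add: hom_def)
  then show "malg_mult (ruffle_monoid n) p q \<in> malg.span (class_sums (ruffle_monoid n) hand)"
    if "p \<in> malg.span (class_sums (ruffle_monoid n) hand)"
      "q \<in> malg.span (class_sums (ruffle_monoid n) hand)" for p q
    using that unfolding sums by (rule malg_mult_in_span_hand_sums)
qed

section \<open>Counting the ruffles that yield an oriented permutation\<close>

text \<open>The least possible increase of the hand from card \<open>k\<close> to card \<open>k + 1\<close>.\<close>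

definition hand_step :: "(int \<Rightarrow> int) \<Rightarrow> nat \<Rightarrow> nat" where
  "hand_step w k =
     (if (w (int k) < 0) \<noteq> (w (int (Suc k)) < 0) then 1
      else if w (int k) < w (int (Suc k)) then 0 else 2)"

text \<open>
  The index \<open>k = 0\<close> is not a card; since \<open>w 0 = 0\<close> it behaves like an unflipped card in hand \<open>0\<close>
  that precedes the deck.
\<close>

definition least_hand :: "(int \<Rightarrow> int) \<Rightarrow> nat \<Rightarrow> nat" where
  "least_hand w k = (\<Sum>j<k. hand_step w j)"

section \<open>Least hands and the freedom beyond them\<close>

lemma least_hand_Suc: "least_hand w (Suc k) = least_hand w k + hand_step w k"
  by (simp add: least_hand_def)

lemma least_hand_mono: "k \<le> l \<Longrightarrow> least_hand w k \<le> least_hand w l"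
  unfolding least_hand_def by (rule sum_mono2) auto

text \<open>A step is odd exactly where the sign changes. The form
  \<open>\<not> w (int k) < 0\<close> includes the base case \<open>w 0 = 0\<close>.\<close>

lemma even_least_hand: "w \<in> oriented_perms n \<Longrightarrow> even (least_hand w k) \<longleftrightarrow> \<not> w (int k) < 0"
proof (induction k)
  case (Suc k)
  then show ?case by (simp add: least_hand_Suc hand_step_def)
qed (simp add: least_hand_def oriented_perms_zero)

text \<open>Equal values force every step in between to be 0, so \<open>w\<close> ascends all the
  way.\<close>

lemma least_hand_eq_imp_less:
  "k < l \<Longrightarrow> least_hand w k = least_hand w l \<Longrightarrow> w (int k) < w (int l)"
proof (induction l)
  case (Suc l)
  then have "least_hand w k \<le> least_hand w l" by (intro least_hand_mono) simp
  then have eq: "least_hand w k = least_hand w l" and "hand_step w l = 0"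
    using Suc.prems(2) by (simp_all add: least_hand_Suc)
  then have "w (int l) < w (int (Suc l))" by (simp add: hand_step_def split: if_splits)
  moreover have "w (int k) \<le> w (int l)"
  proof (cases "k = l")
    case False
    then show ?thesis using Suc.IH Suc.prems(1) eq by simp
  qed simp
  ultimately show ?case by linarith
qed simp

text \<open>The sequences \<open>e\<close> by which the hands
  \<open>least_hand w k + 2 * e k\<close> may exceed the least ones; extensionality makes the
  parametrization unique.\<close>

definition slacks :: "nat \<Rightarrow> (nat \<Rightarrow> nat) set" where
  "slacks n = {e \<in> extensional {1..n}. \<forall>k\<in>{1..n}. \<forall>l\<in>{1..n}. k \<le> l \<longrightarrow> e k \<le> e l}"

lemma slacks_mono: "e \<in> slacks n \<Longrightarrow> k \<in> {1..n} \<Longrightarrow> l \<in> {1..n} \<Longrightarrow> k \<le> l \<Longrightarrow> e k \<le> e l"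
  by (simp add: slacks_def)

text \<open>A sign change changes the parity of the hand, costing at least 1. With equal signs an
  ascent may stay in the hand, while a descent needs a later hand of the same parity, costing at
  least 2.\<close>

lemma deals_hand_step:
  assumes w: "w \<in> oriented_perms n" and d: "deals n x w" and k: "Suc k \<in> {1..n}"
  shows "(if k = 0 then 0 else x (card_pos w k)) + hand_step w k \<le> x (card_pos w (Suc k))"
proof (cases "k = 0")
  \<comment> \<open>The first card needs an odd hand, hence at least 1, exactly when it is
    flipped.\<close>
  case True
  then show ?thesis
    using deals_even[OF d k] oriented_perms_zero[OF w] oriented_perms_nonzero[OF w k]
    by (cases "x (card_pos w (Suc k))") (auto simp: hand_step_def)
next
  case False
  then have k': "k \<in> {1..n}" using k by auto
  define h h' where "h = x (card_pos w k)" and "h' = x (card_pos w (Suc k))"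
  have "even h \<longleftrightarrow> 0 < w (int k)" "even h' \<longleftrightarrow> 0 < w (int (Suc k))"
    "h < h' \<or> h = h' \<and> w (int k) < w (int (Suc k))"
    using deals_even[OF d k] deals_even[OF d k'] deals_less[OF d k' k] by (simp_all add: h_def h'_def)
  moreover have "h + 2 \<le> h'" if "even h = even h'" "h < h'"
    using that by (cases "h' = Suc h") auto
  ultimately have "h + hand_step w k \<le> h'"
    using oriented_perms_nonzero[OF w k] oriented_perms_nonzero[OF w k']
    unfolding hand_step_def by (smt (verit) Suc_leI add_0_right less_or_eq_imp_le plus_1_eq_Suc add.commute)
  then show ?thesis using False by (simp add: h_def h'_def)
qed

text \<open>Summed steps show that the excess over the least hand is weakly increasing; the additive
  form avoids truncated subtraction.\<close>

lemma deals_slack_mono: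
  assumes w: "w \<in> oriented_perms n" and d: "deals n x w"
    and k: "k \<in> {1..n}" and l: "l \<in> {1..n}" and kl: "k \<le> l"
  shows "x (card_pos w k) + least_hand w l \<le> x (card_pos w l) + least_hand w k"
  using kl l
proof (induction l rule: dec_induct)
  case (step l)
  then have "l \<noteq> 0" "l \<in> {1..n}" using k by auto
  then show ?case
    using step deals_hand_step[OF w d, of l] by (simp add: least_hand_Suc)
qed simp

lemma deals_ge_least_hand:
  assumes w: "w \<in> oriented_perms n" and d: "deals n x w" and k: "k \<in> {1..n}"
  shows "least_hand w k \<le> x (card_pos w k)"
proof -
  have one: "1 \<in> {1..n}" using k by auto
  have "least_hand w 1 \<le> x (card_pos w 1)"
    using deals_hand_step[OF w d, of 0] one by (simp add: least_hand_def)
  then show ?thesis using deals_slack_mono[OF w d one k] k by auto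
qed

lemma deals_slack:
  assumes w: "w \<in> oriented_perms n" and d: "deals n x w" and k: "k \<in> {1..n}"
  shows "least_hand w k + 2 * ((x (card_pos w k) - least_hand w k) div 2) = x (card_pos w k)"
proof -
  have "even (x (card_pos w k) - least_hand w k)"
    using deals_even[OF d k] even_least_hand[OF w, of k]
      oriented_perms_nonzero[OF w k] deals_ge_least_hand[OF w d k] by auto
  then show ?thesis using deals_ge_least_hand[OF w d k] by simp
qed

section \<open>Fibres of \<open>orientedruffle\<close> and their sizes\<close>

definition decks :: "nat \<Rightarrow> nat \<Rightarrow> (int \<Rightarrow> int) \<Rightarrow> (nat \<times> (nat \<Rightarrow> nat)) set" where
  "decks n a w = {r \<in> hand_class n a. orientedruffle n r = w}"

text \<open>Since the hands increase weakly along the deck, the bound \<open>a\<close> on all of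
  them amounts to the bound on the hand of the last card \<open>n\<close>.\<close>

lemma decks_bij:
  assumes n: "1 \<le> n" and w: "w \<in> oriented_perms n"
  shows "\<exists>f. bij_betw f {e \<in> slacks n. least_hand w n + 2 * e n < a} (decks n a w)"
proof -
  let ?E = "{e \<in> slacks n. least_hand w n + 2 * e n < a}"
  define p where "p = inv_into {1..n} (card_pos w)"
  \<comment> \<open>\<open>f\<close> deals the hands given by a slack sequence; \<open>g\<close>
    recovers the slack as half the excess over the least hand.\<close>
  define f where "f e = (a, \<lambda>i\<in>{1..n}. least_hand w (p i) + 2 * e (p i))" for e
  define g where "g = (\<lambda>r::nat \<times> (nat \<Rightarrow> nat).
    \<lambda>k\<in>{1..n}. (snd r (card_pos w k) - least_hand w k) div 2)"
  have p: "p (card_pos w k) = k" if "k \<in> {1..n}" for k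
    using bij_betw_inv_into_left[OF card_pos_bij[OF w] that] by (simp add: p_def)
  have f_at: "snd (f e) (card_pos w k) = least_hand w k + 2 * e k" if "k \<in> {1..n}" for e k
    using p[OF that] card_pos_in[OF w that] by (simp add: f_def)
  have decks_iff: "(c, x) \<in> decks n a w \<longleftrightarrow>
      c = a \<and> x \<in> extensional {1..n} \<and> (\<forall>k\<in>{1..n}. x (card_pos w k) < a) \<and> deals n x w" for c x
  proof -
    have "(\<forall>i\<in>{1..n}. x i < a) \<longleftrightarrow> (\<forall>i\<in>card_pos w ` {1..n}. x i < a)"
      using card_pos_bij[OF w] by (simp add: bij_betw_def)
    then show ?thesis
      using w by (auto simp: decks_def hand_class_def orientedruffle_eq_iff PiE_iff)
  qed
  have f_in: "f e \<in> decks n a w" if e: "e \<in> ?E" for e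
  proof -
    define x where "x = snd (f e)"
    have x_at: "x (card_pos w k) = least_hand w k + 2 * e k" if "k \<in> {1..n}" for k
      using f_at[OF that] by (simp add: x_def)
    have mono: "e k \<le> e l" if "k \<in> {1..n}" "l \<in> {1..n}" "k \<le> l" for k l
      using slacks_mono e that by blast
    have "x (card_pos w k) < a" if k: "k \<in> {1..n}" for k
      using mono[of k n] least_hand_mono[of k n w] k e n x_at[OF k] by auto
    moreover have "deals n x w"
      unfolding deals_def
    proof (intro conjI ballI impI)
      fix k assume k: "k \<in> {1..n}"
      then show "even (x (card_pos w k)) \<longleftrightarrow> 0 < w (int k)"
        using even_least_hand[OF w, of k] oriented_perms_nonzero[OF w k]
        by (auto simp: x_at)
    next
      fix k l assume kl: "k \<in> {1..n}" "l \<in> {1..n}" "k < l"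
      \<comment> \<open>Both summands increase weakly, so equal hands force equal least hands, and
        then \<open>w\<close> ascends from \<open>k\<close> to \<open>l\<close>.\<close>
      have "e k \<le> e l" "least_hand w k \<le> least_hand w l"
        using mono[OF kl(1,2)] least_hand_mono[of k l w] kl(3) by simp_all
      then show "x (card_pos w k) < x (card_pos w l) \<or>
          x (card_pos w k) = x (card_pos w l) \<and> w (int k) < w (int l)"
        using least_hand_eq_imp_less[OF kl(3), of w] unfolding x_at[OF kl(1)] x_at[OF kl(2)] by linarith
    qed
    moreover have "f e = (a, x)" "x \<in> extensional {1..n}" by (simp_all add: x_def f_def)
    ultimately show ?thesis by (simp only: decks_iff) blast
  qed
  have g_in: "g r \<in> ?E" and fg: "f (g r) = r" if r: "r \<in> decks n a w" for r
  proof -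
    obtain x where r_eq: "r = (a, x)" and ext: "x \<in> extensional {1..n}"
      and less: "\<And>k. k \<in> {1..n} \<Longrightarrow> x (card_pos w k) < a" and d: "deals n x w"
      using r by (cases r) (auto simp only: decks_iff)
    have g_at: "g r k = (x (card_pos w k) - least_hand w k) div 2" if "k \<in> {1..n}" for k
      using that by (simp add: g_def r_eq)
    have x_at: "least_hand w k + 2 * g r k = x (card_pos w k)" if "k \<in> {1..n}" for k
      using deals_slack[OF w d that] by (simp only: g_at[OF that])
    have "g r k \<le> g r l" if "k \<in> {1..n}" "l \<in> {1..n}" "k \<le> l" for k l
      using deals_slack_mono[OF w d that] x_at[OF that(1)] x_at[OF that(2)] by linarith
    moreover have "least_hand w n + 2 * g r n < a"
      using x_at[of n] less[of n] n by simp
    ultimately show "g r \<in> ?E" by (simp add: slacks_def) (simp add: g_def)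
    have "snd (f (g r)) = x"
    proof (rule extensionalityI[OF _ ext])
      fix i assume "i \<in> {1..n}"
      then obtain k where k: "k \<in> {1..n}" "i = card_pos w k" by (rule card_pos_surj[OF w])
      show "snd (f (g r)) i = x i"
        unfolding k(2) f_at[OF k(1)] by (rule x_at[OF k(1)])
    qed (simp add: f_def)
    then show "f (g r) = r" by (simp add: r_eq f_def)
  qed
  have "g (f e) = e" if "e \<in> ?E" for e
  proof (rule extensionalityI)
    show "g (f e) \<in> extensional {1..n}" by (simp add: g_def)
    show "e \<in> extensional {1..n}" using that by (simp add: slacks_def)
    show "g (f e) k = e k" if "k \<in> {1..n}" for k
      using that f_at[OF that, of e] by (simp add: g_def)
  qed
  then have "bij_betw f ?E (decks n a w)"
    using f_in g_in fg by (intro bij_betw_byWitness[where f' = g]) auto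
  then show ?thesis by blast
qed

text \<open>An \<open>a\<close>-handed ruffle exists iff zero slack fits below \<open>a\<close>.
  Hands are numbered from 0, whence the \<open>+ 1\<close>.\<close>

lemma oriented_rising_eq:
  assumes n: "1 \<le> n" and w: "w \<in> oriented_perms n"
  shows "oriented_rising n w = least_hand w n + 1"
proof -
  have "(\<exists>x. (a, x) \<in> ruffles n \<and> w = orientedruffle n (a, x)) \<longleftrightarrow> least_hand w n < a" for a
  proof -
    \<comment> \<open>With at least one card, a nonempty fibre forces \<open>1 \<le> a\<close>, as
      \<open>ruffles\<close> demands.\<close>
    have "{1..n} \<noteq> {}" using n by simp
    then have "(\<exists>x. (a, x) \<in> ruffles n \<and> w = orientedruffle n (a, x)) \<longleftrightarrow> decks n a w \<noteq> {}"
      by (fastforce simp: decks_def hand_class_def ruffles_def)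
    also have "\<dots> \<longleftrightarrow> {e \<in> slacks n. least_hand w n + 2 * e n < a} \<noteq> {}"
    proof -
      obtain f where "bij_betw f {e \<in> slacks n. least_hand w n + 2 * e n < a} (decks n a w)"
        using decks_bij[OF assms] by blast
      from bij_betw_imp_surj_on[OF this, symmetric] show ?thesis by (simp only: image_is_empty simp_thms)
    qed
    also have "\<dots> \<longleftrightarrow> least_hand w n < a"
    proof
      assume "least_hand w n < a"
      then have "(\<lambda>k\<in>{1..n}. 0) \<in> {e \<in> slacks n. least_hand w n + 2 * e n < a}"
        using n by (simp add: slacks_def)
      then show "{e \<in> slacks n. least_hand w n + 2 * e n < a} \<noteq> {}" by blast
    qed auto
    finally show ?thesis .
  qed
  then show ?thesis
    unfolding oriented_rising_def by (auto intro: Least_equality)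
qed

text \<open>The fibre size as a function of the rising number alone. For \<open>1 \<le> n\<close>
  and \<open>r \<le> a\<close> it is the binomial coefficient of (a - r) div 2 + n over n.\<close>

definition ruffle_count :: "nat \<Rightarrow> nat \<Rightarrow> nat \<Rightarrow> nat" where
  "ruffle_count n a r = card {e \<in> slacks n. r + 2 * e n \<le> a}"

lemma card_decks:
  assumes "1 \<le> n" "w \<in> oriented_perms n"
  shows "card (decks n a w) = ruffle_count n a (oriented_rising n w)"
  using decks_bij[OF assms, of a] bij_betw_same_card
  by (fastforce simp: ruffle_count_def oriented_rising_eq[OF assms] Suc_le_eq)

lemma ruffle_count_eq_0: "a < r \<Longrightarrow> ruffle_count n a r = 0"
  by (simp add: ruffle_count_def)

lemma ruffle_count_self:
  assumes "1 \<le> n"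
  shows "ruffle_count n r r = 1"
proof -
  have "{e \<in> slacks n. r + 2 * e n \<le> r} = {\<lambda>k\<in>{1..n}. 0}"
  proof (intro equalityI subsetI)
    fix e assume e: "e \<in> {e \<in> slacks n. r + 2 * e n \<le> r}"
    have "e = (\<lambda>k\<in>{1..n}. 0)"
    proof (rule extensionalityI)
      show "e k = (\<lambda>k\<in>{1..n}. 0) k" if "k \<in> {1..n}" for k
        \<comment> \<open>The last entry is 0, and it bounds all others.\<close>
        using slacks_mono[of e n k n] e that assms by simp
    qed (use e in \<open>simp_all add: slacks_def\<close>)
    then show "e \<in> {\<lambda>k\<in>{1..n}. 0}" by simp
  qed (use assms in \<open>simp add: slacks_def\<close>)
  then show ?thesis by (simp add: ruffle_count_def)
qed

section \<open>The oriented rising algebra\<close>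

definition rising_sum :: "nat \<Rightarrow> nat \<Rightarrow> ((int \<Rightarrow> int) \<Rightarrow>\<^sub>0 rat)" where
  "rising_sum n r = (\<Sum>w\<in>{w \<in> oriented_perms n. oriented_rising n w = r}. Poly_Mapping.single w 1)"

lemma lookup_rising_sum:
  "Poly_Mapping.lookup (rising_sum n r) w =
    (if w \<in> oriented_perms n \<and> oriented_rising n w = r then 1 else 0)"
  by (simp add: rising_sum_def lookup_sum_single finite_oriented_perms)

lemma class_sums_oriented_rising:
  "class_sums (oriented_perm_group n) (oriented_rising n) =
     rising_sum n ` oriented_rising n ` oriented_perms n"
  by (simp add: class_sums_def level_sets_def rising_sum_def image_image)

text \<open>The coefficient of \<open>w\<close> on the left is the size of its fibre, which is
  constant on each rising class.\<close>

lemma hand_sum_orientedruffle: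
  assumes n: "1 \<le> n"
  shows "hand_sum n (orientedruffle n) a =
    (\<Sum>r\<in>oriented_rising n ` oriented_perms n. malg_scale (of_nat (ruffle_count n a r)) (rising_sum n r))"
    (is "_ = ?rhs")
proof (rule poly_mapping_eqI)
  fix w
  let ?R = "oriented_rising n ` oriented_perms n"
  have "Poly_Mapping.lookup (hand_sum n (orientedruffle n) a) w = of_nat (card (decks n a w))"
    by (simp add: hand_sum_def lookup_sum lookup_single when_def decks_def finite_hand_class
        sum.If_cases Int_def)
  also have "\<dots> = Poly_Mapping.lookup ?rhs w"
  proof (cases "w \<in> oriented_perms n")
    case True
    have "Poly_Mapping.lookup ?rhs w =
        (\<Sum>r\<in>?R. if r = oriented_rising n w then of_nat (ruffle_count n a r) else 0)"
      unfolding lookup_sum using True by (intro sum.cong) (auto simp: lookup_rising_sum)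
    also have "\<dots> = of_nat (ruffle_count n a (oriented_rising n w))"
      using True by (simp add: finite_oriented_perms)
    finally show ?thesis by (simp add: card_decks[OF n True])
  next
    case False
    then have "decks n a w = {}"
      using orientedruffle_in by (auto simp: decks_def)
    then show ?thesis using False by (simp add: lookup_sum lookup_rising_sum)
  qed
  finally show "Poly_Mapping.lookup (hand_sum n (orientedruffle n) a) w = Poly_Mapping.lookup ?rhs w" .
qed

lemma hand_sum_in_span_rising_sums:
  assumes "1 \<le> n"
  shows "hand_sum n (orientedruffle n) a \<in>
    malg.span (class_sums (oriented_perm_group n) (oriented_rising n))"
  unfolding hand_sum_orientedruffle[OF assms] class_sums_oriented_rising
  by (intro malg.span_sum malg.span_scale malg.span_base imageI)

text \<open>Back substitution in the unitriangular system: the hand sum at \<open>r\<close> is the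
  rising sum at \<open>r\<close> plus multiples of earlier rising sums.\<close>

lemma rising_sum_in_span_hand_sums:
  assumes n: "1 \<le> n"
  shows "r \<in> oriented_rising n ` oriented_perms n \<Longrightarrow>
    rising_sum n r \<in> malg.span (hand_sum n (orientedruffle n) ` {1..})"
proof (induction r rule: less_induct)
  case (less r)
  let ?R = "oriented_rising n ` oriented_perms n" and ?S = "malg.span (hand_sum n (orientedruffle n) ` {1..})"
  let ?t = "\<lambda>s. malg_scale (of_nat (ruffle_count n r s)) (rising_sum n s)"
  \<comment> \<open>For \<open>s < r\<close> the induction hypothesis applies; for
    \<open>s > r\<close> the coefficient is 0.\<close>
  have "?t s \<in> ?S" if "s \<in> ?R - {r}" for s
    using that less.IH[of s] ruffle_count_eq_0[of r s n]
    by (cases "s < r") (auto intro: malg.span_scale malg.span_zero)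
  then have rest: "(\<Sum>s\<in>?R - {r}. ?t s) \<in> ?S" by (rule malg.span_sum)
  have "1 \<le> r" using less.prems oriented_rising_eq[OF n] by auto
  then have "hand_sum n (orientedruffle n) r \<in> ?S" by (intro malg.span_base imageI) simp
  moreover have "hand_sum n (orientedruffle n) r = rising_sum n r + (\<Sum>s\<in>?R - {r}. ?t s)"
    unfolding hand_sum_orientedruffle[OF n]
    using less.prems by (subst sum.remove[of _ r]) (auto simp: finite_oriented_perms ruffle_count_self[OF n])
  ultimately show ?case using malg.span_diff[OF _ rest] by fastforce
qed

theorem mainTheorem2:
  fixes n :: nat
  assumes "n \<ge> 1"
  shows "does_the_right_thing (ruffle_monoid n) (oriented_perm_group n)
           hand (oriented_rising n) (orientedruffle n)
    \<and> lumping (oriented_perm_group n) (oriented_rising n)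
    \<and> malg_subalgebra (oriented_perm_group n) (oriented_rising_algebra n)
    \<and> malg_basis_of (class_sums (oriented_perm_group n) (oriented_rising n))
           (oriented_rising_algebra n)
    \<and> (\<forall>p \<in> oriented_rising_algebra n. \<forall>q \<in> oriented_rising_algebra n.
           malg_mult (oriented_perm_group n) p q = malg_mult (oriented_perm_group n) q p)"
proof -
  let ?G = "oriented_perm_group n" and ?f = "orientedruffle n"
  let ?C = "class_sums ?G (oriented_rising n)"
  have hom: "?f \<in> hom (ruffle_monoid n) ?G"
    using monoid_hom_orientedruffle by (simp add: monoid_hom_def)
  have subset: "hand_sum n ?f ` {1..} \<subseteq> malg.span ?C"
    using hand_sum_in_span_rising_sums[OF assms] by blast
  have "?C \<subseteq> malg.span (hand_sum n ?f ` {1..})"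
    unfolding class_sums_oriented_rising using rising_sum_in_span_hand_sums[OF assms] by blast
  then have span: "malg.span (hand_sum n ?f ` {1..}) = malg.span ?C"
    using subset by (simp add: malg.span_eq)
  have fin: "finite_level_sets ?G (oriented_rising n)"
    by (auto simp: finite_level_sets_def level_sets_def finite_oriented_perms)
  \<comment> \<open>Equality of the spans transfers closure under products from the hand sums to the
    rising class sums; commutativity is transferred the same way below.\<close>
  note lump = lumpingI[OF monoid_oriented_perm_group fin,
      OF malg_mult_in_span_hand_sums[OF hom, unfolded span]]
  have "does_the_right_thing (ruffle_monoid n) ?G hand (oriented_rising n) ?f"
    unfolding does_the_right_thing_def image_class_sums_hand
    using lumping_hand monoid_oriented_perm_group fin monoid_hom_orientedruffle subset span by blast
  then show ?thesis
    using lump malg_mult_commute_hand_sums[OF hom, unfolded span]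
    unfolding oriented_rising_algebra_def by blast
qed

end
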